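(* The confluent hypergeometric function $\mathrm H_{4,3}^0$ of four variables has the expansion $$\mathrm H_{4,3}^0(a,b_1,b_2,b_3;d_1,d_2,d_3;x,y,z,t)=(1-x)^{-b_1}(1-y)^{-b_2}(1-z)^{-b_3}$$ $$\times\sum_{l,m,n,s=0}^\infty\ \sum_{q=0}^s\ \sum_{\substack{i,j,k\ge0\\ i+j+k=s}}A(s,q)\,s!\,\binom sq\,\frac{(-1)^{s+q}(a)_{l+m+n+s}(b_1)_{i+l+m}(b_2)_{j+l+n}(b_3)_{k+m+n}}{(a)_s(1-a)_q(d_1)_{i+l+m}(d_2)_{j+l+n}(d_3)_{k+m+n}\,i!\,j!\,k!\,n!\,m!\,l!\,q!}\;t^q$$ $$\times\left(\frac{x}{1-x}\right)^{i+l+m}F\!\left(d_1-a-j-k,\,b_1+i+l+m;\,d_1+i+l+m;\,\frac{x}{x-1}\right)$$ $$\times\left(\frac{y}{1-y}\right)^{j+l+n}F\!\left(d_2-a-i-k-m,\,b_2+j+l+n;\,d_2+j+l+n;\,\frac{y}{y-1}\right)$$ $$\times\left(\frac{z}{1-z}\right)^{k+m+n}F\!\left(d_3-a-i-j-l,\,b_3+k+m+n;\,d_3+k+m+n;\,\frac{z}{z-1}\right)\;{}_0F_1(1-a+q;-t).$$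
   Context: The Pochhammer symbol is $(\kappa)_m=\Gamma(\kappa+m)/\Gamma(\kappa)$ for an integer $m$, where $\kappa\ne0,-1,-2,\dots$ if $(\kappa)_m$ stands in a denominator; $a$ is a complex number. The confluent hypergeometric function of four variables is $$\mathrm H_{4,3}^0(a,b_1,b_2,b_3;d_1,d_2,d_3;x,y,z,t)=\sum_{m,n,k,l=0}^\infty\frac{(a)_{m+n+k-l}(b_1)_m(b_2)_n(b_3)_k}{(d_1)_m(d_2)_n(d_3)_k\,m!\,n!\,k!\,l!}\,x^my^nz^kt^l,\qquad |x|+|y|+|z|<1.$$ $F(a,b;c;x)=\sum_{n\ge0}\frac{(a)_n(b)_n}{(c)_n\,n!}x^n$ is the Gauss hypergeometric function and ${}_0F_1(a;x)=\sum_{n\ge0}\frac{x^n}{(a)_n\,n!}$ is a generalized hypergeometric function. The numbers $A(s,q)$ are defined by $A(0,0)=1$ and $A(s,q)=q/s$ for $s\ge1$, $q\ge0$; $\binom sq$ is the binomial coefficient.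
   Formalization: The multiple series can diverge for |x|+|y|+|z|<1. Shown: it converges absolutely if |x|+|y|+|z|<1/2; and for |x|+|y|+|z|<1 with |x/(x-1)|, |y/(y-1)|, |z/(z-1)|<1 (so that the series F converge), the expansion holds wherever the multiple series converges absolutely. *)

theory Defs
  imports "HOL-Analysis.Analysis"
begin

text \<open>The Pochhammer symbol with an integer index.  The library constant \<open>pochhammer\<close> (a product)
  covers natural indices; it is used for these because it has the right value also for
  \<open>\<kappa> = 0, -1, -2, \<dots>\<close>, where the quotient of Gamma values is only meaningful as a limit.\<close>

definition pochhammer_int :: "complex \<Rightarrow> int \<Rightarrow> complex" where
  "pochhammer_int \<kappa> m = Gamma (\<kappa> + of_int m) / Gamma \<kappa>"

lemma pochhammer_int_of_nat:
  assumes "\<kappa> \<notin> \<int>\<^sub>\<le>\<^sub>0"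
  shows "pochhammer_int \<kappa> (int n) = pochhammer \<kappa> n"
  using pochhammer_Gamma[OF assms] by (simp add: pochhammer_int_def)

definition gauss_F :: "complex \<Rightarrow> complex \<Rightarrow> complex \<Rightarrow> complex \<Rightarrow> complex" where
  "gauss_F a b c x =
     (\<Sum>n. pochhammer a n * pochhammer b n / (pochhammer c n * fact n) * x ^ n)"

definition hyp_0F1 :: "complex \<Rightarrow> complex \<Rightarrow> complex" where
  "hyp_0F1 a x = (\<Sum>n. x ^ n / (pochhammer a n * fact n))"

definition H043 ::
  "complex \<Rightarrow> complex \<Rightarrow> complex \<Rightarrow> complex \<Rightarrow> complex \<Rightarrow> complex \<Rightarrow> complex
    \<Rightarrow> complex \<Rightarrow> complex \<Rightarrow> complex \<Rightarrow> complex \<Rightarrow> complex" where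
  "H043 a b1 b2 b3 d1 d2 d3 x y z t =
     (\<Sum>\<^sub>\<infinity>(m, n, k, l)\<in>(UNIV :: (nat \<times> nat \<times> nat \<times> nat) set).
        pochhammer_int a (int m + int n + int k - int l)
          * pochhammer b1 m * pochhammer b2 n * pochhammer b3 k
        / (pochhammer d1 m * pochhammer d2 n * pochhammer d3 k
             * fact m * fact n * fact k * fact l)
        * x ^ m * y ^ n * z ^ k * t ^ l)"

text \<open>Only \<open>q \<le> s\<close> is ever used, so the value for \<open>s = 0 < q\<close> does not matter.\<close>

definition A_coeff :: "nat \<Rightarrow> nat \<Rightarrow> complex" where
  "A_coeff s q = (if s = 0 \<and> q = 0 then 1 else of_nat q / of_nat s)"

text \<open>The summand of the outer fourfold series over \<open>l, m, n, s\<close>, i.e. including the two finite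
  inner sums over \<open>q\<close> and over the triples \<open>i + j + k = s\<close>.\<close>

definition H043_expansion_term ::
  "complex \<Rightarrow> complex \<Rightarrow> complex \<Rightarrow> complex \<Rightarrow> complex \<Rightarrow> complex \<Rightarrow> complex
    \<Rightarrow> complex \<Rightarrow> complex \<Rightarrow> complex \<Rightarrow> complex \<Rightarrow> nat \<times> nat \<times> nat \<times> nat \<Rightarrow> complex" where
  "H043_expansion_term a b1 b2 b3 d1 d2 d3 x y z t = (\<lambda>(l, m, n, s).
     \<Sum>q\<le>s. \<Sum>(i, j, k)\<in>{(i, j, k). i + j + k = s}.
       A_coeff s q * fact s * of_nat (s choose q)
       * ((-1) ^ (s + q) * pochhammer a (l + m + n + s)
            * pochhammer b1 (i + l + m) * pochhammer b2 (j + l + n) * pochhammer b3 (k + m + n)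
          / (pochhammer a s * pochhammer (1 - a) q
            * pochhammer d1 (i + l + m) * pochhammer d2 (j + l + n) * pochhammer d3 (k + m + n)
            * fact i * fact j * fact k * fact n * fact m * fact l * fact q))
       * t ^ q
       * (x / (1 - x)) ^ (i + l + m)
       * gauss_F (d1 - a - of_nat j - of_nat k) (b1 + of_nat (i + l + m)) (d1 + of_nat (i + l + m))
                 (x / (x - 1))
       * (y / (1 - y)) ^ (j + l + n)
       * gauss_F (d2 - a - of_nat i - of_nat k - of_nat m) (b2 + of_nat (j + l + n))
                 (d2 + of_nat (j + l + n)) (y / (y - 1))
       * (z / (1 - z)) ^ (k + m + n)
       * gauss_F (d3 - a - of_nat i - of_nat j - of_nat l) (b3 + of_nat (k + m + n))
                 (d3 + of_nat (k + m + n)) (z / (z - 1))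
       * hyp_0F1 (1 - a + of_nat q) (- t))"

end

theory Submission
  imports Defs "HOL-Complex_Analysis.Complex_Analysis"
begin

text \<open>
  Why the expansion holds.  Write \<open>B\<^sub>1 M = (b1)\<^sub>M x\<^sup>M / (d1)\<^sub>M\<close>, likewise \<open>B\<^sub>2\<close>, \<open>B\<^sub>3\<close>, let \<open>h T\<close> be the
  sum of \<open>B\<^sub>1 M B\<^sub>2 N B\<^sub>3 K / (M! N! K!)\<close> over \<open>M + N + K = T\<close>, and put \<open>f T = (a)\<^sub>T h T\<close> and
  \<open>\<tau> p = (- t)\<^sup>p / ((1 - a)\<^sub>p p!)\<close>.  Since \<open>\<Gamma>(a + T - p) / \<Gamma>(a) t\<^sup>p / p! = \<tau> p (a - p)\<^sub>T\<close>, the function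
  \<open>H\<close> is the sum over \<open>T\<close> of \<open>f T\<close> times \<open>\<lambda> T\<close>, the sum over \<open>p\<close> of \<open>\<tau> p (a - p)\<^sub>T / (a)\<^sub>T\<close>
  (lemma \<open>H_infsum\<close>).

  On the other side three things happen.  Pfaff's transformation absorbs the powers of \<open>1 - x\<close>,
  \<open>1 - y\<close>, \<open>1 - z\<close> and turns each Gauss function into one of argument \<open>x\<close>, \<open>y\<close>, \<open>z\<close>
  (\<open>gauss_factor_eq_pochhammer_series\<close>).  The sum over \<open>q\<close> separates from the sum over \<open>i, j, k\<close>
  and equals \<open>c s\<close>, the sum over \<open>p\<close> of \<open>\<tau> p (p)\<^sub>s\<close> (\<open>coeff_moment_eq_q_sum\<close>).  The sum over
  \<open>l, m, n\<close> is the Burchnall-Chaundy expansion of a Lauricella series with parameters shifted by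
  \<open>s, i, j, k\<close> (\<open>bc_outer_has_sum\<close>); together with the sum over \<open>i + j + k = s\<close> it produces the
  number \<open>g s / (a)\<^sub>s\<close>, where \<open>g s\<close> is the sum over \<open>T\<close> of \<open>binom T s f T\<close>
  (\<open>shifted_lauricella_sum\<close>).  So the right-hand side is the sum over \<open>s\<close> of \<open>(- 1)\<^sup>s \<mu> s g s\<close>
  with \<open>\<mu> s = c s / (a)\<^sub>s\<close>, while Vandermonde's identity says that \<open>\<lambda>\<close> is the binomial transform
  of \<open>\<mu>\<close>.  The theorem is the interchange of the sums over \<open>s\<close> and \<open>T\<close>.

  For \<open>\<bar>x\<bar> + \<bar>y\<bar> + \<bar>z\<bar> < 1 / 2\<close> everything converges absolutely: the sum over \<open>l, m, n\<close> of the
  absolute values is at most a constant times \<open>\<rho>\<^sup>s (1 - \<rho>)\<^sup>-\<^sup>s \<bar>c s\<bar> / s!\<close> whenever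
  \<open>\<bar>x\<bar> + \<bar>y\<bar> + \<bar>z\<bar> < \<rho> < 1\<close>, and \<open>c s / s!\<close> grows slower than every exponential (\<open>expansion_summable\<close>).
  Beyond \<open>1 / 2\<close> the double series need not converge absolutely, and only the grouped series over \<open>s\<close> is known to.
  The interchange is then an Abelian theorem
  (\<open>binomial_resummation\<close>): inserting \<open>\<zeta>\<^sup>s\<close> makes the two sides analytic functions of \<open>\<zeta>\<close>, one on the
  unit disc and continuous up to the boundary, the other on a disc around \<open>1\<close> of radius larger
  than \<open>1\<close>; they agree near \<open>0\<close> and hence at \<open>\<zeta> = 1\<close>.  The second disc exists because the
  polynomials in \<open>\<zeta>\<close> that arise can be rewritten in powers of \<open>1 - \<zeta>\<close> with coefficients of
  subexponential size (\<open>binomial_reflection\<close>, \<open>coeff_transform_bound\<close>).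
\<close>

text \<open>Two notions of absolute summability carry the same infix symbol; below it always means
  summability of the norms in the sense of unordered sums.\<close>

no_notation Infinite_Set_Sum.abs_summable_on (infix \<open>abs'_summable'_on\<close> 50)

section \<open>Vandermonde and Burchnall-Chaundy identities for coefficients\<close>

text \<open>The Chu-Vandermonde identity with the second factor shifted instead of shortened.  This form yields
  both the Burchnall-Chaundy coefficients (\<open>p = - M\<close>) and Pfaff's transformation (\<open>p = C - A\<close>).\<close>

lemma vandermonde_alternating:
  fixes a p :: "'a::field_char_0"
  shows "(\<Sum>s\<le>n. of_nat (n choose s) * (- 1) ^ s * pochhammer p s * pochhammer (a + of_nat s) (n - s))
       = pochhammer (a - p) n"
proof -
  have term_eq: "of_nat (n choose s) * (- 1) ^ s * pochhammer p s * pochhammer (a + of_nat s) (n - s)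
      = fact n * (((- p) gchoose s) * ((a + of_nat n - 1) gchoose (n - s)))" if "s \<le> n" for s
  proof -
    have *: "a + of_nat n - 1 - of_nat (n - s) + 1 = a + of_nat s"
      using that by (simp add: of_nat_diff)
    show ?thesis
      unfolding gbinomial_pochhammer[of "- p"] gbinomial_pochhammer'[of "a + of_nat n - 1"] *
      using that by (simp add: binomial_fact field_simps)
  qed
  have "(\<Sum>s\<le>n. of_nat (n choose s) * (- 1) ^ s * pochhammer p s * pochhammer (a + of_nat s) (n - s))
      = fact n * (\<Sum>s\<in>{0..n}. ((- p) gchoose s) * ((a + of_nat n - 1) gchoose (n - s)))"
    by (simp add: term_eq sum_distrib_left atLeast0AtMost)
  also have "\<dots> = fact n * ((a - p + of_nat n - 1) gchoose n)"
    by (simp add: gbinomial_Vandermonde algebra_simps)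
  also have "\<dots> = pochhammer (a - p) n"
    by (simp add: gbinomial_pochhammer')
  finally show ?thesis .
qed

lemma pochhammer_minus_of_nat:
  "pochhammer (- of_nat N :: 'a::field_char_0) r = (- 1) ^ r * fact r * of_nat (N choose r)"
  by (simp add: binomial_gbinomial gbinomial_pochhammer flip: power_add power2_eq_square mult_2
      power_mult_distrib)

text \<open>Splitting \<open>(A)\<^sub>M\<^sub>+\<^sub>N = (A)\<^sub>M (A + M)\<^sub>N\<close>, this is Vandermonde's identity for \<open>(A - (- M))\<^sub>N\<close>: the factor
  \<open>(- M)\<^sub>r\<close> cuts the sum off at \<open>r = M\<close>.\<close>

lemma burchnall_chaundy_two:
  fixes A :: "'a::field_char_0"
  shows "(\<Sum>r\<in>{r. r \<le> M \<and> r \<le> N}. pochhammer A r * pochhammer (A + of_nat r) (M - r)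
            * pochhammer (A + of_nat r) (N - r) / (fact r * fact (M - r) * fact (N - r)))
       = pochhammer A (M + N) / (fact M * fact N)"
proof -
  have "pochhammer A (M + N) / (fact M * fact N)
      = pochhammer A M * pochhammer (A - (- of_nat M)) N / (fact M * fact N)"
    by (simp add: pochhammer_product')
  also have "\<dots> = (\<Sum>r\<le>N. pochhammer A M / (fact M * fact N) * (of_nat (N choose r) * (- 1) ^ r
                  * pochhammer (- of_nat M) r * pochhammer (A + of_nat r) (N - r)))"
    unfolding vandermonde_alternating[symmetric] by (simp add: sum_distrib_left sum_divide_distrib)
  also have "\<dots> = (\<Sum>r\<in>{r. r \<le> M \<and> r \<le> N}. pochhammer A M / (fact M * fact N)
                  * (of_nat (N choose r) * (- 1) ^ r
                  * pochhammer (- of_nat M) r * pochhammer (A + of_nat r) (N - r)))"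
    by (rule sum.mono_neutral_right) (auto simp: pochhammer_minus_of_nat)
  also have "\<dots> = (\<Sum>r\<in>{r. r \<le> M \<and> r \<le> N}. pochhammer A r * pochhammer (A + of_nat r) (M - r)
            * pochhammer (A + of_nat r) (N - r) / (fact r * fact (M - r) * fact (N - r)))"
  proof (rule sum.cong[OF refl], goal_cases)
    case (1 r)
    hence r: "r \<le> M" "r \<le> N" by auto
    have s: "(- 1 :: 'a) ^ r * (- 1) ^ r = 1"
      by (simp flip: power_mult_distrib)
    have "pochhammer A M = pochhammer A r * pochhammer (A + of_nat r) (M - r)"
      using r by (metis pochhammer_product)
    thus ?case
      using r s unfolding pochhammer_minus_of_nat by (simp add: binomial_fact field_simps)
  qed
  finally show ?thesis by simp
qed

text \<open>The triples that contribute to the coefficient of \<open>x\<^sup>M y\<^sup>N z\<^sup>K\<close> in the Burchnall-Chaundy expansion,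
  whose summand has lowest monomial \<open>x\<^sup>l\<^sup>+\<^sup>m y\<^sup>l\<^sup>+\<^sup>n z\<^sup>m\<^sup>+\<^sup>n\<close>.\<close>

definition bc_fibre :: "nat \<times> nat \<times> nat \<Rightarrow> (nat \<times> nat \<times> nat) set" where
  "bc_fibre = (\<lambda>(M, N, K). {(l, m, n). l + m \<le> M \<and> l + n \<le> N \<and> m + n \<le> K})"

text \<open>Two applications of the identity for two exponents: first \<open>M\<close> is separated from \<open>N + K\<close>, at the cost
  of an index \<open>r = l + m\<close> which Vandermonde's convolution splits between \<open>N\<close> and \<open>K\<close>; then \<open>N - l\<close> is
  separated from \<open>K - m\<close>, which brings in \<open>n\<close>.  The first step is the reason why \<open>A + l + m\<close> goes with
  \<open>x\<close>, but \<open>A + l + m + n\<close> with \<open>y\<close> and \<open>z\<close>.\<close>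

lemma burchnall_chaundy_three:
  fixes A :: "'a::field_char_0"
  shows "(\<Sum>(l, m, n)\<in>bc_fibre (M, N, K).
            pochhammer A (l + m + n) * pochhammer (A + of_nat (l + m)) (M - (l + m))
            * pochhammer (A + of_nat (l + m + n)) (N - (l + n))
            * pochhammer (A + of_nat (l + m + n)) (K - (m + n))
            / (fact l * fact m * fact n * fact (M - (l + m)) * fact (N - (l + n)) * fact (K - (m + n))))
       = pochhammer A (M + N + K) / (fact M * fact N * fact K)" (is "?lhs = _")
proof -
  define g :: "nat \<Rightarrow> 'a" where
    "g r = pochhammer A r * pochhammer (A + of_nat r) (M - r) / fact (M - r)" for r
  define G where "G l m n = pochhammer (A + of_nat (l + m)) n
            * pochhammer (A + of_nat (l + m + n)) (N - (l + n))
            * pochhammer (A + of_nat (l + m + n)) (K - (m + n))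
            / (fact n * fact (N - (l + n)) * fact (K - (m + n)))" for l m n
  have inner: "(\<Sum>n\<in>{n. n \<le> N - l \<and> n \<le> K - m}. G l m n)
      = pochhammer (A + of_nat (l + m)) (N - l + (K - m)) / (fact (N - l) * fact (K - m))" for l m
    unfolding burchnall_chaundy_two[symmetric] G_def
    by (intro sum.cong) (auto simp: algebra_simps)
  define E where "E = {(r, l). r \<le> M \<and> l \<le> r \<and> l \<le> N \<and> r - l \<le> K}"
  have "?lhs = (\<Sum>(l, m, n)\<in>bc_fibre (M, N, K). g (l + m) / (fact l * fact m) * G l m n)"
    by (intro sum.cong) (auto simp: g_def G_def pochhammer_product' field_simps)
  also have "\<dots> = (\<Sum>((r, l), n)\<in>Sigma E (\<lambda>(r, l). {n. n \<le> N - l \<and> n \<le> K - (r - l)}).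
        g r / (fact l * fact (r - l)) * G l (r - l) n)"
    by (rule sum.reindex_bij_witness[of _ "\<lambda>((r, l), n). (l, r - l, n)" "\<lambda>(l, m, n). ((l + m, l), n)"])
       (auto simp: bc_fibre_def E_def)
  also have "\<dots> = (\<Sum>(r, l)\<in>E. \<Sum>n\<in>{n. n \<le> N - l \<and> n \<le> K - (r - l)}.
        g r / (fact l * fact (r - l)) * G l (r - l) n)"
  proof -
    have fin: "finite E"
      by (rule finite_subset[of _ "{..M} \<times> {..M}"]) (auto simp: E_def)
    show ?thesis
      using sum.Sigma[OF fin, of "\<lambda>(r, l). {n. n \<le> N - l \<and> n \<le> K - (r - l)}"
          "\<lambda>(r, l) n. g r / (fact l * fact (r - l)) * G l (r - l) n"]
      by (simp add: split_def)
  qed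
  also have "\<dots> = (\<Sum>(r, l)\<in>E. g r / (fact l * fact (r - l)) *
       (pochhammer (A + of_nat r) (N + K - r) / (fact (N - l) * fact (K - (r - l)))))"
    unfolding sum_distrib_left[symmetric] inner
    by (intro sum.cong) (auto simp: E_def)
  also have "\<dots> = (\<Sum>(r, l)\<in>E. g r * pochhammer (A + of_nat r) (N + K - r) / (fact N * fact K)
       * of_nat ((N choose l) * (K choose (r - l))))"
    by (intro sum.cong) (auto simp: E_def binomial_fact field_simps)
  also have "\<dots> = (\<Sum>(r, l)\<in>Sigma {r. r \<le> M \<and> r \<le> N + K} (\<lambda>r. {..r}).
       g r * pochhammer (A + of_nat r) (N + K - r) / (fact N * fact K)
       * of_nat ((N choose l) * (K choose (r - l))))"
    by (rule sum.mono_neutral_left) (auto simp: E_def)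
  also have "\<dots> = (\<Sum>r\<in>{r. r \<le> M \<and> r \<le> N + K}. g r * pochhammer (A + of_nat r) (N + K - r)
       / (fact N * fact K) * of_nat ((N + K) choose r))"
    unfolding vandermonde[symmetric] of_nat_sum sum_distrib_left
    by (subst sum.Sigma) auto
  also have "\<dots> = (\<Sum>r\<in>{r. r \<le> M \<and> r \<le> N + K}. fact (N + K) / (fact N * fact K) *
       (pochhammer A r * pochhammer (A + of_nat r) (M - r)
            * pochhammer (A + of_nat r) (N + K - r) / (fact r * fact (M - r) * fact (N + K - r))))"
    by (intro sum.cong) (auto simp: g_def binomial_fact field_simps)
  also have "\<dots> = fact (N + K) / (fact N * fact K) * (pochhammer A (M + (N + K)) / (fact M * fact (N + K)))"
    unfolding burchnall_chaundy_two[symmetric] sum_distrib_left ..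
  also have "\<dots> = pochhammer A (M + N + K) / (fact M * fact N * fact K)"
    by (simp add: add.assoc)
  finally show ?thesis .
qed

section \<open>Growth of Pochhammer symbols and the binomial series\<close>

text \<open>All majorants come from this: replacing the parameter by its absolute value keeps every
  combinatorial identity valid, so the majorants can be summed in closed form.\<close>

lemma norm_pochhammer_le:
  fixes a :: "'a::{real_normed_field}"
  assumes "norm a \<le> c"
  shows "norm (pochhammer a n) \<le> pochhammer c n"
  unfolding pochhammer_prod prod_norm[symmetric]
proof (rule prod_mono)
  fix i
  have "norm (a + of_nat i) \<le> norm a + norm (of_nat i :: 'a)" by (rule norm_triangle_ineq)
  thus "0 \<le> norm (a + of_nat i) \<and> norm (a + of_nat i) \<le> c + of_nat i"
    using assms by simp
qed

lemma pochhammer_nonneg_real: "0 \<le> (b::real) \<Longrightarrow> 0 \<le> pochhammer b n"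
  by (rule order_trans[OF norm_ge_zero norm_pochhammer_le[of b b n]]) simp

lemma binomial_series_has_sum:
  fixes \<beta> r :: real
  assumes "0 \<le> \<beta>" "0 \<le> r" "r < 1"
  shows "((\<lambda>n. pochhammer \<beta> n / fact n * r ^ n) has_sum (1 - r) powr (- \<beta>)) UNIV"
proof (rule sums_nonneg_imp_has_sum)
  have "(\<lambda>n. ((- \<beta>) gchoose n) * (- r) ^ n) sums (1 + (- r)) powr (- \<beta>)"
    by (rule gen_binomial_real) (use assms in auto)
  also have "(\<lambda>n. ((- \<beta>) gchoose n) * (- r) ^ n) = (\<lambda>n. pochhammer \<beta> n / fact n * r ^ n)"
  proof
    fix n
    have "(- 1 :: real) ^ n * (- 1) ^ n = 1" by (simp flip: power_mult_distrib)
    thus "((- \<beta>) gchoose n) * (- r) ^ n = pochhammer \<beta> n / fact n * r ^ n"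
      unfolding gbinomial_pochhammer power_minus[of r] by (simp add: field_simps)
  qed
  finally show "(\<lambda>n. pochhammer \<beta> n / fact n * r ^ n) sums (1 - r) powr (- \<beta>)" by simp
qed (use assms in \<open>auto intro!: mult_nonneg_nonneg divide_nonneg_nonneg pochhammer_nonneg_real\<close>)

lemma binomial_series_complex:
  fixes b x :: complex
  assumes "norm x < 1"
  shows "(\<lambda>n. pochhammer b n / fact n * x ^ n) sums (1 - x) powr (- b)"
proof -
  have "(\<lambda>n. ((- b) gchoose n) * (- x) ^ n) sums (1 + (- x)) powr (- b)"
    by (rule gen_binomial_complex) (use assms in auto)
  also have "(\<lambda>n. ((- b) gchoose n) * (- x) ^ n) = (\<lambda>n. pochhammer b n / fact n * x ^ n)"
  proof
    fix n
    have "(- 1 :: complex) ^ n * (- 1) ^ n = 1" by (simp flip: power_mult_distrib)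
    thus "((- b) gchoose n) * (- x) ^ n = pochhammer b n / fact n * x ^ n"
      unfolding gbinomial_pochhammer power_minus[of x] by (simp add: field_simps)
  qed
  finally show ?thesis by simp
qed

lemma eventually_ratio_le_imp_bound:
  fixes v :: "nat \<Rightarrow> 'a::real_normed_vector" and q :: real
  assumes "eventually (\<lambda>n. norm (v (Suc n)) \<le> q * norm (v n)) sequentially" "q > 0"
  shows "\<exists>D>0. \<forall>n. norm (v n) \<le> D * q ^ n"
proof -
  from assms obtain N where N: "\<And>n. n \<ge> N \<Longrightarrow> norm (v (Suc n)) \<le> q * norm (v n)"
    by (auto simp: eventually_sequentially)
  define D where "D = 1 + (\<Sum>k\<le>N. norm (v k) / q ^ k)"
  have small: "norm (v n) \<le> D * q ^ n" if "n \<le> N" for n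
  proof -
    have "norm (v n) / q ^ n \<le> (\<Sum>k\<le>N. norm (v k) / q ^ k)"
      using that assms(2) by (intro member_le_sum) auto
    hence "norm (v n) / q ^ n \<le> D" by (simp add: D_def)
    thus ?thesis using assms(2) by (simp add: field_simps)
  qed
  have "norm (v n) \<le> D * q ^ n" for n
  proof (induction n)
    case (Suc n)
    show ?case
    proof (cases "Suc n \<le> N")
      case False
      hence "norm (v (Suc n)) \<le> q * norm (v n)" by (intro N) auto
      also have "\<dots> \<le> q * (D * q ^ n)" using Suc assms(2) by (intro mult_left_mono) auto
      finally show ?thesis by (simp add: mult_ac)
    qed (rule small)
  qed (rule small, simp)
  moreover have "D > 0"
    unfolding D_def using assms(2) by (intro add_pos_nonneg sum_nonneg) auto
  ultimately show ?thesis by blast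
qed

text \<open>The quotient of consecutive terms tends to \<open>1\<close>, so the growth is slower than every exponential.\<close>

lemma pochhammer_ratio_bound:
  fixes b d :: complex and q :: real
  assumes "d \<notin> \<int>\<^sub>\<le>\<^sub>0" "q > 1"
  shows "\<exists>D>0. \<forall>n. norm (pochhammer b n / pochhammer d n) \<le> D * q ^ n"
proof (rule eventually_ratio_le_imp_bound)
  have "(\<lambda>n. (b + of_nat n) / (d + of_nat n)) \<longlonglongrightarrow> 1"
  proof -
    have "(\<lambda>n. 1 + (b - d) * (1 / (d + of_nat n))) \<longlonglongrightarrow> 1 + (b - d) * 0"
    proof (intro tendsto_intros)
      have "filterlim (\<lambda>n. d + of_nat n) at_infinity sequentially"
        by (rule tendsto_add_filterlim_at_infinity[OF tendsto_const])
           (rule tendsto_of_nat)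
      thus "(\<lambda>n. 1 / (d + of_nat n)) \<longlonglongrightarrow> 0"
        using tendsto_divide_0[OF tendsto_const] by blast
    qed
    moreover have "d + of_nat n \<noteq> 0" for n
      using assms(1) plus_of_nat_eq_0_imp by blast
    ultimately show ?thesis by (simp add: field_simps)
  qed
  hence "(\<lambda>n. norm ((b + of_nat n) / (d + of_nat n))) \<longlonglongrightarrow> 1"
    using tendsto_norm by fastforce
  hence "eventually (\<lambda>n. norm ((b + of_nat n) / (d + of_nat n)) < q) sequentially"
    using assms(2) by (rule order_tendstoD)
  thus "eventually (\<lambda>n. norm (pochhammer b (Suc n) / pochhammer d (Suc n))
          \<le> q * norm (pochhammer b n / pochhammer d n)) sequentially"
  proof eventually_elim
    case (elim n)
    have "norm (pochhammer b (Suc n) / pochhammer d (Suc n))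
        = norm ((b + of_nat n) / (d + of_nat n)) * norm (pochhammer b n / pochhammer d n)"
      by (simp add: pochhammer_Suc norm_mult norm_divide mult_ac)
    thus ?case using elim by (metis less_imp_le mult_right_mono norm_ge_zero)
  qed
qed (use assms in auto)

section \<open>Multiple series regrouped by degree\<close>

lemma has_sum_fibres_iff:
  "((\<lambda>(y, x). f x) has_sum S) (Sigma UNIV (\<lambda>y. {x. h x = y})) \<longleftrightarrow> (f has_sum S) UNIV"
  by (rule has_sum_reindex_bij_witness[of _ "\<lambda>x. (h x, x)" "\<lambda>(y, x). x"]) auto

text \<open>Together with the next lemma this is the rule by which multiple series are reorganised by
  total degree: a nonnegative family may be summed fibre by fibre, and an absolutely convergent
  one has the same sum as its fibre sums.\<close>

lemma has_sum_fibres_nonneg: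
  fixes f :: "'a \<Rightarrow> real"
  assumes "\<And>x. 0 \<le> f x" "\<And>y. finite {x. h x = y}"
    and "((\<lambda>y. \<Sum>x\<in>{x. h x = y}. f x) has_sum S) UNIV"
  shows "(f has_sum S) UNIV"
  unfolding has_sum_fibres_iff[of f h S, symmetric]
proof (rule has_sum_SigmaI)
  show "((\<lambda>x. case (y, x) of (y, x) \<Rightarrow> f x) has_sum (\<Sum>x\<in>{x. h x = y}. f x)) {x. h x = y}" for y
    using assms(2) by (simp add: has_sum_finite)
  thus "(\<lambda>(y, x). f x) summable_on Sigma UNIV (\<lambda>y. {x. h x = y})"
    by (rule summable_on_SigmaI) (use assms has_sum_imp_summable in auto)
qed (fact assms(3))

lemma has_sum_fibres:
  fixes f :: "'a \<Rightarrow> 'c::banach"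
  assumes "(f has_sum S) UNIV" "\<And>y. finite {x. h x = y}"
  shows "((\<lambda>y. \<Sum>x\<in>{x. h x = y}. f x) has_sum S) UNIV"
proof (rule has_sum_SigmaD)
  show "((\<lambda>(y, x). f x) has_sum S) (Sigma UNIV (\<lambda>y. {x. h x = y}))"
    unfolding has_sum_fibres_iff by fact
  show "((\<lambda>x. case (y, x) of (y, x) \<Rightarrow> f x) has_sum (\<Sum>x\<in>{x. h x = y}. f x)) {x. h x = y}" for y
    using assms(2) by (simp add: has_sum_finite)
qed

definition triples :: "nat \<Rightarrow> (nat \<times> nat \<times> nat) set" where
  "triples s = {(i, j, k). i + j + k = s}"

lemma triples_fibre: "{x. (\<lambda>(i, j, k). i + j + k) x = s} = triples s"
  by (auto simp: triples_def)

lemma finite_triples: "finite (triples s)"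
  by (rule finite_subset[of _ "{..s} \<times> {..s} \<times> {..s}"]) (auto simp: triples_def)

lemma sum_triples: "(\<Sum>(i, j, k)\<in>triples s. f i j k) = (\<Sum>i\<le>s. \<Sum>j\<le>s - i. f i j (s - i - j))"
proof -
  have "(\<Sum>(i, j, k)\<in>triples s. f i j k) = (\<Sum>(i, j)\<in>Sigma {..s} (\<lambda>i. {..s - i}). f i j (s - i - j))"
    by (rule sum.reindex_bij_witness[of _ "\<lambda>(i, j). (i, j, s - i - j)" "\<lambda>(i, j, k). (i, j)"])
       (auto simp: triples_def)
  thus ?thesis by (simp add: sum.Sigma)
qed

lemma multinomial_triples:
  fixes x y z :: "'a::field_char_0"
  shows "(\<Sum>(i, j, k)\<in>triples s. x ^ i * y ^ j * z ^ k / (fact i * fact j * fact k)) = (x + y + z) ^ s / fact s"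
proof -
  have binom: "(\<Sum>i\<le>n. u ^ i * v ^ (n - i) / (fact i * fact (n - i))) = (u + v) ^ n / fact n"
    for u v :: 'a and n
    unfolding binomial_ring sum_divide_distrib
    by (intro sum.cong) (auto simp: binomial_fact)
  have "(\<Sum>(i, j, k)\<in>triples s. x ^ i * y ^ j * z ^ k / (fact i * fact j * fact k))
      = (\<Sum>i\<le>s. x ^ i / fact i * (\<Sum>j\<le>s - i. y ^ j * z ^ (s - i - j) / (fact j * fact (s - i - j))))"
    unfolding sum_triples sum_distrib_left by (intro sum.cong) (auto simp: mult_ac)
  also have "\<dots> = (\<Sum>i\<le>s. x ^ i * (y + z) ^ (s - i) / (fact i * fact (s - i)))"
    by (intro sum.cong refl, subst binom) simp
  also have "\<dots> = (x + y + z) ^ s / fact s"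
    using binom[of x "y + z" s] by (simp add: add.assoc)
  finally show ?thesis .
qed

section \<open>The Burchnall-Chaundy expansion of a Lauricella series\<close>

text \<open>The terms of a Lauricella series \<open>F\<^sub>A\<close> in three variables; the factors \<open>B1\<close>, \<open>B2\<close>, \<open>B3\<close> are left
  arbitrary so that the same results apply to the series with shifted parameters.\<close>

definition lauricella_term ::
  "'a::field_char_0 \<Rightarrow> (nat \<Rightarrow> 'a) \<Rightarrow> (nat \<Rightarrow> 'a) \<Rightarrow> (nat \<Rightarrow> 'a) \<Rightarrow> nat \<times> nat \<times> nat \<Rightarrow> 'a" where
  "lauricella_term A B1 B2 B3 = (\<lambda>(M, N, K).
     pochhammer A (M + N + K) / (fact M * fact N * fact K) * (B1 M * B2 N * B3 K))"

lemma lauricella_majorant: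
  fixes \<beta> x y z C1 C2 C3 :: real
  assumes "0 \<le> \<beta>" "0 \<le> x" "0 \<le> y" "0 \<le> z" "x + y + z < 1" "0 \<le> C1" "0 \<le> C2" "0 \<le> C3"
  shows "(lauricella_term \<beta> (\<lambda>M. C1 * x ^ M) (\<lambda>N. C2 * y ^ N) (\<lambda>K. C3 * z ^ K)
            has_sum (C1 * C2 * C3) * (1 - (x + y + z)) powr (- \<beta>)) UNIV"
proof (rule has_sum_fibres_nonneg[where h = "\<lambda>(i, j, k). i + j + k"])
  show "0 \<le> lauricella_term \<beta> (\<lambda>M. C1 * x ^ M) (\<lambda>N. C2 * y ^ N) (\<lambda>K. C3 * z ^ K) p" for p
    using assms by (cases p) (auto simp: lauricella_term_def pochhammer_nonneg_real)
  show "finite {p. (\<lambda>(i, j, k). i + j + k) p = (T :: nat)}" for T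
    unfolding triples_fibre by (rule finite_triples)
  have "(\<Sum>p\<in>triples T. lauricella_term \<beta> (\<lambda>M. C1 * x ^ M) (\<lambda>N. C2 * y ^ N) (\<lambda>K. C3 * z ^ K) p)
      = (C1 * C2 * C3) * (pochhammer \<beta> T / fact T * (x + y + z) ^ T)" for T
  proof -
    have "(\<Sum>p\<in>triples T. lauricella_term \<beta> (\<lambda>M. C1 * x ^ M) (\<lambda>N. C2 * y ^ N) (\<lambda>K. C3 * z ^ K) p)
      = (\<Sum>(i, j, k)\<in>triples T. (C1 * C2 * C3) * pochhammer \<beta> T * (x ^ i * y ^ j * z ^ k / (fact i * fact j * fact k)))"
      by (intro sum.cong) (auto simp: lauricella_term_def triples_def power3_eq_cube)
    also have "\<dots> = (C1 * C2 * C3) * pochhammer \<beta> T * ((x + y + z) ^ T / fact T)"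
      unfolding multinomial_triples[symmetric] sum_distrib_left by (intro sum.cong) auto
    finally show ?thesis by simp
  qed
  thus "((\<lambda>T. \<Sum>p\<in>{p. (\<lambda>(i, j, k). i + j + k) p = T}.
      lauricella_term \<beta> (\<lambda>M. C1 * x ^ M) (\<lambda>N. C2 * y ^ N) (\<lambda>K. C3 * z ^ K) p)
      has_sum (C1 * C2 * C3) * (1 - (x + y + z)) powr - \<beta>) UNIV"
    unfolding triples_fibre using has_sum_cmult_right[OF binomial_series_has_sum[of \<beta> "x + y + z"], of "(C1 * C2 * C3)"] assms
    by simp
qed

text \<open>The Burchnall-Chaundy expansion written out in full: \<open>(l, m, n)\<close> are the outer indices, \<open>(u, v, w)\<close>
  the indices of the three Gauss series.\<close>

definition bc_term ::
  "'a::field_char_0 \<Rightarrow> (nat \<Rightarrow> 'a) \<Rightarrow> (nat \<Rightarrow> 'a) \<Rightarrow> (nat \<Rightarrow> 'a)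
    \<Rightarrow> (nat \<times> nat \<times> nat) \<times> (nat \<times> nat \<times> nat) \<Rightarrow> 'a" where
  "bc_term A B1 B2 B3 = (\<lambda>((l, m, n), (u, v, w)).
     pochhammer A (l + m + n) / (fact l * fact m * fact n)
     * ((pochhammer (A + of_nat (l + m)) u / fact u * B1 (l + m + u))
     * ((pochhammer (A + of_nat (l + m + n)) v / fact v * B2 (l + n + v))
     * (pochhammer (A + of_nat (l + m + n)) w / fact w * B3 (m + n + w)))))"

definition bc_degree :: "(nat \<times> nat \<times> nat) \<times> (nat \<times> nat \<times> nat) \<Rightarrow> nat \<times> nat \<times> nat" where
  "bc_degree = (\<lambda>((l, m, n), (u, v, w)). (l + m + u, l + n + v, m + n + w))"

lemma finite_bc_degree: "finite {p. bc_degree p = P}"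
proof -
  obtain M N K where P: "P = (M, N, K)" by (cases P)
  show ?thesis
    by (rule finite_subset[of _ "({..M} \<times> {..M} \<times> {..N}) \<times> ({..M} \<times> {..N} \<times> {..K})"])
       (auto simp: bc_degree_def P)
qed

text \<open>Regrouping by the exponents of \<open>x\<close>, \<open>y\<close>, \<open>z\<close> turns the expansion back into the Lauricella series.\<close>

lemma bc_term_fibre:
  "(\<Sum>p\<in>{p. bc_degree p = P}. bc_term A B1 B2 B3 p) = lauricella_term A B1 B2 B3 P"
proof -
  obtain M N K where P: "P = (M, N, K)" by (cases P)
  have "(\<Sum>p\<in>{p. bc_degree p = P}. bc_term A B1 B2 B3 p)
     = (\<Sum>(l, m, n)\<in>bc_fibre (M, N, K).
         pochhammer A (l + m + n) * pochhammer (A + of_nat (l + m)) (M - (l + m))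
            * pochhammer (A + of_nat (l + m + n)) (N - (l + n))
            * pochhammer (A + of_nat (l + m + n)) (K - (m + n))
            / (fact l * fact m * fact n * fact (M - (l + m)) * fact (N - (l + n)) * fact (K - (m + n)))
            * (B1 M * B2 N * B3 K))"
    by (rule sum.reindex_bij_witness
          [of _ "\<lambda>(l, m, n). ((l, m, n), (M - (l + m), N - (l + n), K - (m + n)))" fst])
       (auto simp: bc_fibre_def bc_degree_def bc_term_def P mult_ac)
  also have "\<dots> = lauricella_term A B1 B2 B3 P"
    unfolding P lauricella_term_def prod.case burchnall_chaundy_three[symmetric] sum_distrib_right
    by (intro sum.cong) auto
  finally show ?thesis .
qed

lemma bc_majorant:
  fixes \<beta> x y z C1 C2 C3 :: real
  assumes "0 \<le> \<beta>" "0 \<le> x" "0 \<le> y" "0 \<le> z" "x + y + z < 1" "0 \<le> C1" "0 \<le> C2" "0 \<le> C3"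
  shows "(bc_term \<beta> (\<lambda>M. C1 * x ^ M) (\<lambda>N. C2 * y ^ N) (\<lambda>K. C3 * z ^ K)
            has_sum (C1 * C2 * C3) * (1 - (x + y + z)) powr (- \<beta>)) UNIV"
proof (rule has_sum_fibres_nonneg[where h = bc_degree, OF _ finite_bc_degree])
  show "0 \<le> bc_term \<beta> (\<lambda>M. C1 * x ^ M) (\<lambda>N. C2 * y ^ N) (\<lambda>K. C3 * z ^ K) p" for p
    using assms by (cases p) (auto simp: bc_term_def pochhammer_nonneg_real)
qed (simp add: bc_term_fibre lauricella_majorant assms)

lemma norm_lauricella_term_le:
  fixes A :: complex
  assumes "norm A \<le> \<beta>" "0 \<le> C1" "0 \<le> C2" "0 \<le> C3" "0 \<le> x" "0 \<le> y" "0 \<le> z" "\<And>M. norm (B1 M) \<le> C1 * x ^ M" "\<And>M. norm (B2 M) \<le> C2 * y ^ M"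
    "\<And>M. norm (B3 M) \<le> C3 * z ^ M"
  shows "norm (lauricella_term A B1 B2 B3 p)
      \<le> lauricella_term \<beta> (\<lambda>M. C1 * x ^ M) (\<lambda>N. C2 * y ^ N) (\<lambda>K. C3 * z ^ K) p"
proof -
  obtain M N K where p: "p = (M, N, K)" by (cases p)
  have "0 \<le> \<beta>" using assms(1) norm_ge_zero order_trans by blast
  thus ?thesis
    unfolding p lauricella_term_def prod.case norm_mult norm_divide norm_fact
    by (intro mult_mono divide_right_mono norm_pochhammer_le assms)
       (use assms in \<open>auto intro!: mult_nonneg_nonneg divide_nonneg_nonneg pochhammer_nonneg_real\<close>)
qed

lemma norm_bc_term_le:
  fixes A :: complex
  assumes "norm A \<le> \<beta>" "0 \<le> C1" "0 \<le> C2" "0 \<le> C3" "0 \<le> x" "0 \<le> y" "0 \<le> z" "\<And>M. norm (B1 M) \<le> C1 * x ^ M" "\<And>M. norm (B2 M) \<le> C2 * y ^ M"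
    "\<And>M. norm (B3 M) \<le> C3 * z ^ M"
  shows "norm (bc_term A B1 B2 B3 p)
      \<le> bc_term \<beta> (\<lambda>M. C1 * x ^ M) (\<lambda>N. C2 * y ^ N) (\<lambda>K. C3 * z ^ K) p"
proof -
  obtain l m n u v w where p: "p = ((l, m, n), (u, v, w))" by (metis surj_pair)
  have \<beta>: "0 \<le> \<beta>" using assms(1) norm_ge_zero order_trans by blast
  have shift: "norm (A + of_nat k) \<le> \<beta> + of_nat k" for k
    using norm_triangle_ineq[of A "of_nat k"] assms(1) by simp
  show ?thesis
    unfolding p bc_term_def prod.case norm_mult norm_divide norm_fact
    by (intro mult_mono divide_right_mono norm_pochhammer_le assms shift)
       (use \<beta> assms in \<open>auto intro!: mult_nonneg_nonneg divide_nonneg_nonneg pochhammer_nonneg_real\<close>)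
qed

lemma has_sum_times_abs:
  fixes f :: "'a \<Rightarrow> complex" and g :: "'b \<Rightarrow> complex"
  assumes "f abs_summable_on UNIV" "g abs_summable_on UNIV" "(f has_sum F) UNIV" "(g has_sum G) UNIV"
  shows "(\<lambda>(x, y). f x * g y) abs_summable_on UNIV" "((\<lambda>(x, y). f x * g y) has_sum F * G) UNIV"
proof -
  have "(\<lambda>(x, y). f x * g y) abs_summable_on (UNIV \<times> UNIV)"
    unfolding Infinite_Sum.abs_summable_on_Sigma_iff using assms(1,2)
    by (auto simp: norm_mult infsum_cmult_right' infsum_nonneg
          intro!: summable_on_cmult_right summable_on_cmult_left)
  thus abs: "(\<lambda>(x, y). f x * g y) abs_summable_on UNIV" by simp
  have "((\<lambda>(x, y). f x * g y) has_sum F * G) (UNIV \<times> UNIV)"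
  proof (rule has_sum_SigmaI)
    show "((\<lambda>y. case (x, y) of (x, y) \<Rightarrow> f x * g y) has_sum f x * G) UNIV" for x
      using assms(4) by (simp add: has_sum_cmult_right)
    show "((\<lambda>x. f x * G) has_sum F * G) UNIV"
      using assms(3) by (rule has_sum_cmult_left)
    show "(\<lambda>(x, y). f x * g y) summable_on UNIV \<times> UNIV"
      using abs abs_summable_summable by force
  qed
  thus "((\<lambda>(x, y). f x * g y) has_sum F * G) UNIV" by simp
qed

definition pochhammer_series :: "complex \<Rightarrow> (nat \<Rightarrow> complex) \<Rightarrow> complex" where
  "pochhammer_series A B = (\<Sum>u. pochhammer A u / fact u * B u)"

lemma pochhammer_series_has_sum:
  fixes B :: "nat \<Rightarrow> complex"
  assumes "0 \<le> x" "x < 1" "\<And>u. norm (B u) \<le> C * x ^ u"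
  shows "(\<lambda>u. pochhammer A u / fact u * B u) abs_summable_on UNIV"
    "((\<lambda>u. pochhammer A u / fact u * B u) has_sum pochhammer_series A B) UNIV"
proof -
  have "((\<lambda>u. C * (pochhammer (norm A) u / fact u * x ^ u)) has_sum C * (1 - x) powr (- norm A)) UNIV"
    by (intro has_sum_cmult_right binomial_series_has_sum) (use assms in auto)
  hence sm: "(\<lambda>u. C * (pochhammer (norm A) u / fact u * x ^ u)) summable_on UNIV"
    by (rule has_sum_imp_summable)
  have "norm (pochhammer A u / fact u * B u) \<le> C * (pochhammer (norm A) u / fact u * x ^ u)" for u
  proof -
    have "norm (pochhammer A u / fact u * B u) \<le> (pochhammer (norm A) u / fact u) * (C * x ^ u)"
      unfolding norm_mult norm_divide norm_fact
      by (intro mult_mono divide_right_mono norm_pochhammer_le assms)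
         (auto intro!: divide_nonneg_nonneg pochhammer_nonneg_real)
    thus ?thesis by (simp add: mult_ac)
  qed
  thus abs: "(\<lambda>u. pochhammer A u / fact u * B u) abs_summable_on UNIV"
    using sm by (intro Infinite_Sum.abs_summable_on_comparison_test') auto
  have "((\<lambda>u. pochhammer A u / fact u * B u) has_sum (\<Sum>\<^sub>\<infinity>u. pochhammer A u / fact u * B u)) UNIV"
    by (rule has_sum_infsum[OF abs_summable_summable[OF abs]])
  moreover from this have "(\<Sum>\<^sub>\<infinity>u. pochhammer A u / fact u * B u) = pochhammer_series A B"
    unfolding pochhammer_series_def by (metis has_sum_imp_sums sums_unique)
  ultimately show "((\<lambda>u. pochhammer A u / fact u * B u) has_sum pochhammer_series A B) UNIV"
    by simp
qed

text \<open>The expansion summed over \<open>(u, v, w)\<close>, in the form in which it occurs in the theorem.\<close>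

definition bc_outer ::
  "complex \<Rightarrow> (nat \<Rightarrow> complex) \<Rightarrow> (nat \<Rightarrow> complex) \<Rightarrow> (nat \<Rightarrow> complex) \<Rightarrow> nat \<times> nat \<times> nat \<Rightarrow> complex" where
  "bc_outer A B1 B2 B3 = (\<lambda>(l, m, n).
     pochhammer A (l + m + n) / (fact l * fact m * fact n)
     * (pochhammer_series (A + of_nat (l + m)) (\<lambda>u. B1 (l + m + u))
     * (pochhammer_series (A + of_nat (l + m + n)) (\<lambda>v. B2 (l + n + v))
     * pochhammer_series (A + of_nat (l + m + n)) (\<lambda>w. B3 (m + n + w)))))"

context
  fixes A :: complex and B1 B2 B3 :: "nat \<Rightarrow> complex" and \<beta> C1 C2 C3 x y z :: real
  assumes A: "norm A \<le> \<beta>" and nonneg: "0 \<le> x" "0 \<le> y" "0 \<le> z" and lt: "x + y + z < 1" 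
    and C: "0 \<le> C1" "0 \<le> C2" "0 \<le> C3"
    and B: "\<And>M. norm (B1 M) \<le> C1 * x ^ M" "\<And>M. norm (B2 M) \<le> C2 * y ^ M"
       "\<And>M. norm (B3 M) \<le> C3 * z ^ M"
begin

lemma beta_nonneg: "0 \<le> \<beta>"
  using A norm_ge_zero order_trans by blast

lemma lauricella_abs_summable: "lauricella_term A B1 B2 B3 abs_summable_on UNIV"
proof (rule Infinite_Sum.abs_summable_on_comparison_test')
  show "lauricella_term \<beta> (\<lambda>M. C1 * x ^ M) (\<lambda>N. C2 * y ^ N) (\<lambda>K. C3 * z ^ K) summable_on UNIV"
    using lauricella_majorant[OF beta_nonneg nonneg lt C] has_sum_imp_summable by blast
qed (rule norm_lauricella_term_le[OF A C nonneg B])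

lemma lauricella_abs_le:
  "(\<Sum>\<^sub>\<infinity>p. norm (lauricella_term A B1 B2 B3 p)) \<le> (C1 * C2 * C3) * (1 - (x + y + z)) powr (- \<beta>)"
proof -
  have "((\<lambda>p. norm (lauricella_term A B1 B2 B3 p)) has_sum
      (\<Sum>\<^sub>\<infinity>p. norm (lauricella_term A B1 B2 B3 p))) UNIV"
    using lauricella_abs_summable by (rule has_sum_infsum)
  thus ?thesis
    by (rule has_sum_mono[OF _ lauricella_majorant[OF beta_nonneg nonneg lt C]])
       (rule norm_lauricella_term_le[OF A C nonneg B])
qed

lemma bc_abs_summable: "bc_term A B1 B2 B3 abs_summable_on UNIV"
proof (rule Infinite_Sum.abs_summable_on_comparison_test')
  show "bc_term \<beta> (\<lambda>M. C1 * x ^ M) (\<lambda>N. C2 * y ^ N) (\<lambda>K. C3 * z ^ K) summable_on UNIV"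
    using bc_majorant[OF beta_nonneg nonneg lt C] has_sum_imp_summable by blast
qed (rule norm_bc_term_le[OF A C nonneg B])

lemma bc_abs_le:
  "(\<Sum>\<^sub>\<infinity>p. norm (bc_term A B1 B2 B3 p)) \<le> (C1 * C2 * C3) * (1 - (x + y + z)) powr (- \<beta>)"
proof -
  have "((\<lambda>p. norm (bc_term A B1 B2 B3 p)) has_sum (\<Sum>\<^sub>\<infinity>p. norm (bc_term A B1 B2 B3 p))) UNIV"
    using bc_abs_summable by (rule has_sum_infsum)
  thus ?thesis
    by (rule has_sum_mono[OF _ bc_majorant[OF beta_nonneg nonneg lt C]])
       (rule norm_bc_term_le[OF A C nonneg B])
qed

lemma bc_inner_has_sum:
  "((\<lambda>q. bc_term A B1 B2 B3 (p, q)) has_sum bc_outer A B1 B2 B3 p) UNIV"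
proof -
  obtain l m n where p: "p = (l, m, n)" by (cases p)
  have b1: "norm (B1 (k + u)) \<le> (C1 * x ^ k) * x ^ u" for k u using B(1)[of "k + u"] by (simp add: power_add mult_ac)
  have b2: "norm (B2 (k + u)) \<le> (C2 * y ^ k) * y ^ u" for k u using B(2)[of "k + u"] by (simp add: power_add mult_ac)
  have b3: "norm (B3 (k + u)) \<le> (C3 * z ^ k) * z ^ u" for k u using B(3)[of "k + u"] by (simp add: power_add mult_ac)
  have lt1: "x < 1" "y < 1" "z < 1" using nonneg lt by auto
  note s1 = pochhammer_series_has_sum[of x "\<lambda>u. B1 (l + m + u)", OF nonneg(1) lt1(1) b1]
  note s2 = pochhammer_series_has_sum[of y "\<lambda>u. B2 (l + n + u)", OF nonneg(2) lt1(2) b2]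
  note s3 = pochhammer_series_has_sum[of z "\<lambda>u. B3 (m + n + u)", OF nonneg(3) lt1(3) b3]
  note s23 = has_sum_times_abs[OF s2(1) s3(1) s2(2) s3(2)]
  note s123 = has_sum_times_abs[OF s1(1) s23(1) s1(2) s23(2)]
  show ?thesis
    using has_sum_cmult_right[OF s123(2), of "pochhammer A (l + m + n) / (fact l * fact m * fact n)"]
    by (simp add: bc_term_def bc_outer_def p split_def)
qed

lemma bc_outer_abs_summable: "bc_outer A B1 B2 B3 abs_summable_on UNIV"
  and bc_outer_abs_le:
    "(\<Sum>\<^sub>\<infinity>p. norm (bc_outer A B1 B2 B3 p)) \<le> (C1 * C2 * C3) * (1 - (x + y + z)) powr (- \<beta>)"
proof -
  define G where "G p = (\<Sum>\<^sub>\<infinity>q. norm (bc_term A B1 B2 B3 (p, q)))" for p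
  have abs: "bc_term A B1 B2 B3 abs_summable_on (UNIV \<times> UNIV)"
    using bc_abs_summable by simp
  have slice: "(\<lambda>q. norm (bc_term A B1 B2 B3 (p, q))) summable_on UNIV" for p
    using abs unfolding Infinite_Sum.abs_summable_on_Sigma_iff by blast
  have G: "(G has_sum (\<Sum>\<^sub>\<infinity>p. norm (bc_term A B1 B2 B3 p))) UNIV"
  proof (rule has_sum_SigmaD)
    show "((\<lambda>p. norm (bc_term A B1 B2 B3 p)) has_sum (\<Sum>\<^sub>\<infinity>p. norm (bc_term A B1 B2 B3 p))) (UNIV \<times> UNIV)"
      using abs by simp
    show "((\<lambda>q. norm (bc_term A B1 B2 B3 (p, q))) has_sum G p) UNIV" for p
      unfolding G_def using slice by (rule has_sum_infsum)
  qed
  have le: "norm (bc_outer A B1 B2 B3 p) \<le> G p" for p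
    using norm_infsum_bound[OF slice[of p]] infsumI[OF bc_inner_has_sum[of p]] by (simp add: G_def)
  show s: "bc_outer A B1 B2 B3 abs_summable_on UNIV"
    by (rule Infinite_Sum.abs_summable_on_comparison_test'[of G]) (use G le has_sum_imp_summable in auto)
  have "(\<Sum>\<^sub>\<infinity>p. norm (bc_outer A B1 B2 B3 p)) \<le> (\<Sum>\<^sub>\<infinity>p. norm (bc_term A B1 B2 B3 p))"
    by (rule has_sum_mono[OF has_sum_infsum[OF s] G]) (use le in auto)
  also note bc_abs_le
  finally show "(\<Sum>\<^sub>\<infinity>p. norm (bc_outer A B1 B2 B3 p)) \<le> (C1 * C2 * C3) * (1 - (x + y + z)) powr (- \<beta>)" .
qed

lemma bc_outer_has_sum:
  "(bc_outer A B1 B2 B3 has_sum (\<Sum>\<^sub>\<infinity>P. lauricella_term A B1 B2 B3 P)) UNIV"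
proof -
  define S where "S = (\<Sum>\<^sub>\<infinity>p. bc_term A B1 B2 B3 p)"
  have S: "(bc_term A B1 B2 B3 has_sum S) UNIV"
    unfolding S_def by (rule has_sum_infsum[OF abs_summable_summable[OF bc_abs_summable]])
  have "(lauricella_term A B1 B2 B3 has_sum S) UNIV"
    using has_sum_fibres[OF S finite_bc_degree] by (simp add: bc_term_fibre)
  hence "S = (\<Sum>\<^sub>\<infinity>P. lauricella_term A B1 B2 B3 P)" by (simp add: infsumI)
  moreover have "(bc_outer A B1 B2 B3 has_sum S) UNIV"
    by (rule has_sum_SigmaD[OF _ bc_inner_has_sum]) (use S in simp)
  ultimately show ?thesis by simp
qed

end

section \<open>Lauricella series with shifted parameters\<close>

lemma vandermonde_three:
  "(\<Sum>(i, j, k)\<in>triples s. (P choose i) * (Q choose j) * (R choose k)) = (P + Q + R) choose s"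
proof -
  have "(\<Sum>(i, j, k)\<in>triples s. (P choose i) * (Q choose j) * (R choose k))
      = (\<Sum>i\<le>s. (P choose i) * (\<Sum>j\<le>s - i. (Q choose j) * (R choose (s - i - j))))"
    unfolding sum_triples sum_distrib_left by (simp add: mult_ac)
  also have "\<dots> = (P + Q + R) choose s"
    unfolding vandermonde by (simp add: vandermonde add.assoc)
  finally show ?thesis .
qed

definition hom_coeff :: "(nat \<Rightarrow> complex) \<Rightarrow> (nat \<Rightarrow> complex) \<Rightarrow> (nat \<Rightarrow> complex) \<Rightarrow> nat \<Rightarrow> complex" where
  "hom_coeff B1 B2 B3 T = (\<Sum>(M, N, K)\<in>triples T. B1 M * B2 N * B3 K / (fact M * fact N * fact K))"

lemma lauricella_term_triples:
  "(\<Sum>p\<in>triples T. lauricella_term A B1 B2 B3 p) = pochhammer A T * hom_coeff B1 B2 B3 T"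
  unfolding hom_coeff_def sum_distrib_left
  by (intro sum.cong) (auto simp: lauricella_term_def triples_def)

text \<open>Counting the ways to split off \<open>(i, j, k)\<close> with \<open>i + j + k = s\<close> from a fixed exponent of total degree
  \<open>T + s\<close> gives a single binomial coefficient, by Vandermonde's convolution for three factors.\<close>

lemma hom_coeff_shift:
  "(\<Sum>(i, j, k)\<in>triples s. hom_coeff (\<lambda>M. B1 (i + M)) (\<lambda>N. B2 (j + N)) (\<lambda>K. B3 (k + K)) T
        / (fact i * fact j * fact k))
   = of_nat ((T + s) choose s) * hom_coeff B1 B2 B3 (T + s)"
proof -
  define b where "b = (\<lambda>(P, Q, R). B1 P * B2 Q * B3 R / (fact P * fact Q * fact R))"
  define c :: "nat \<times> nat \<times> nat \<Rightarrow> nat \<times> nat \<times> nat \<Rightarrow> nat"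
    where "c = (\<lambda>(P, Q, R) (i, j, k). (P choose i) * (Q choose j) * (R choose k))"
  define low where "low = (\<lambda>(P, Q, R). {(i, j, k). (i, j, k) \<in> triples s \<and> i \<le> P \<and> j \<le> Q \<and> k \<le> (R::nat)})"
  have fin: "finite (low p)" for p
    by (rule finite_subset[OF _ finite_triples[of s]]) (auto simp: low_def)
  have "(\<Sum>(i, j, k)\<in>triples s. hom_coeff (\<lambda>M. B1 (i + M)) (\<lambda>N. B2 (j + N)) (\<lambda>K. B3 (k + K)) T
        / (fact i * fact j * fact k))
     = (\<Sum>p\<in>triples s. \<Sum>q\<in>triples T. case (p, q) of ((i, j, k), (M, N, K)) \<Rightarrow>
         B1 (i + M) * B2 (j + N) * B3 (k + K) / (fact M * fact N * fact K) / (fact i * fact j * fact k))"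
    unfolding hom_coeff_def split_def sum_divide_distrib by simp
  also have "\<dots> = (\<Sum>((i, j, k), (M, N, K))\<in>triples s \<times> triples T.
         B1 (i + M) * B2 (j + N) * B3 (k + K) / (fact M * fact N * fact K) / (fact i * fact j * fact k))"
    unfolding sum.cartesian_product by (intro sum.cong) auto
  also have "\<dots> = (\<Sum>(p, q)\<in>Sigma (triples (T + s)) low. b p * of_nat (c p q))"
  proof (rule sum.reindex_bij_witness
      [of _ "\<lambda>((P, Q, R), (i, j, k)). ((i, j, k), (P - i, Q - j, R - k))"
            "\<lambda>((i, j, k), (M, N, K)). ((i + M, j + N, k + K), (i, j, k))"], goal_cases)
    case (5 x)
    obtain i j k M N K where x: "x = ((i, j, k), (M, N, K))" by (metis surj_pair)
    show ?case
      unfolding x prod.case b_def c_def of_nat_mult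
      by (simp add: binomial_fact)
  qed (auto simp: low_def triples_def)
  also have "\<dots> = (\<Sum>p\<in>triples (T + s). b p * of_nat (\<Sum>q\<in>low p. c p q))"
    by (subst sum.Sigma[symmetric]) (simp_all add: finite_triples fin sum_distrib_left)
  also have "\<dots> = (\<Sum>p\<in>triples (T + s). b p * of_nat ((T + s) choose s))"
  proof (intro sum.cong refl, goal_cases)
    case (1 p)
    obtain P Q R where p: "p = (P, Q, R)" by (cases p)
    have "(\<Sum>q\<in>low p. c p q) = (\<Sum>q\<in>triples s. c p q)"
      by (rule sum.mono_neutral_left[OF finite_triples]) (auto simp: low_def p c_def)
    also have "\<dots> = (P + Q + R) choose s"
      unfolding vandermonde_three[symmetric] by (simp add: c_def p)
    also have "P + Q + R = T + s" using 1 by (simp add: triples_def p)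
    finally show ?case by simp
  qed
  also have "\<dots> = of_nat ((T + s) choose s) * hom_coeff B1 B2 B3 (T + s)"
    unfolding hom_coeff_def b_def sum_distrib_left by (intro sum.cong) auto
  finally show ?thesis .
qed

lemma has_sum_finite_sum:
  fixes f :: "'i \<Rightarrow> 'a \<Rightarrow> 'b::topological_comm_monoid_add"
  assumes "finite I" "\<And>i. i \<in> I \<Longrightarrow> (f i has_sum S i) A"
  shows "((\<lambda>x. \<Sum>i\<in>I. f i x) has_sum (\<Sum>i\<in>I. S i)) A"
  using assms by (induction I rule: finite_induct) (auto intro!: has_sum_add)

lemma lauricella_by_degree:
  assumes "norm A \<le> \<beta>" "0 \<le> x" "0 \<le> y" "0 \<le> z" "x + y + z < 1" "0 \<le> C1" "0 \<le> C2" "0 \<le> C3"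
    "\<And>M. norm (B1 M) \<le> C1 * x ^ M" "\<And>M. norm (B2 M) \<le> C2 * y ^ M" "\<And>M. norm (B3 M) \<le> C3 * z ^ M"
  shows "((\<lambda>T. pochhammer A T * hom_coeff B1 B2 B3 T) has_sum (\<Sum>\<^sub>\<infinity>p. lauricella_term A B1 B2 B3 p)) UNIV"
proof -
  have "(lauricella_term A B1 B2 B3 has_sum (\<Sum>\<^sub>\<infinity>p. lauricella_term A B1 B2 B3 p)) UNIV"
    by (rule has_sum_infsum[OF abs_summable_summable[OF lauricella_abs_summable[OF assms]]])
  from has_sum_fibres[OF this, of "\<lambda>(i, j, k). i + j + k"] show ?thesis
    unfolding triples_fibre lauricella_term_triples using finite_triples by simp
qed

lemma shifted_bound:
  fixes B :: "nat \<Rightarrow> complex"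
  assumes "\<And>M. norm (B M) \<le> C * x ^ M" "0 \<le> x" "x \<le> 1" "0 \<le> C"
  shows "norm (B (i + M)) \<le> C * x ^ M"
proof -
  have "norm (B (i + M)) \<le> C * (x ^ i * x ^ M)" using assms(1)[of "i + M"] by (simp add: power_add)
  also have "\<dots> \<le> C * (1 * x ^ M)"
    using assms by (intro mult_left_mono mult_right_mono power_le_one) auto
  finally show ?thesis by simp
qed

lemma norm_hom_coeff_le:
  assumes "0 \<le> x" "0 \<le> y" "0 \<le> z" "0 \<le> C1" "0 \<le> C2" "0 \<le> C3"
    "\<And>M. norm (B1 M) \<le> C1 * x ^ M" "\<And>M. norm (B2 M) \<le> C2 * y ^ M" "\<And>M. norm (B3 M) \<le> C3 * z ^ M"
  shows "norm (hom_coeff B1 B2 B3 T) \<le> (C1 * C2 * C3) * (x + y + z) ^ T / fact T"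
proof -
  have "norm (hom_coeff B1 B2 B3 T) \<le> (\<Sum>(M, N, K)\<in>triples T. (C1 * C2 * C3) * (x ^ M * y ^ N * z ^ K / (fact M * fact N * fact K)))"
    unfolding hom_coeff_def
  proof (rule sum_norm_le)
    fix p assume "p \<in> triples T"
    obtain M N K where p: "p = (M, N, K)" by (cases p)
    have "norm (B1 M * B2 N * B3 K) \<le> (C1 * x ^ M) * (C2 * y ^ N) * (C3 * z ^ K)"
      unfolding norm_mult using assms by (intro mult_mono) auto
    hence "norm (B1 M * B2 N * B3 K / (fact M * fact N * fact K))
        \<le> (C1 * x ^ M) * (C2 * y ^ N) * (C3 * z ^ K) / (fact M * fact N * fact K)"
      unfolding norm_divide norm_mult norm_fact by (intro divide_right_mono) auto
    thus "norm (case p of (M, N, K) \<Rightarrow> B1 M * B2 N * B3 K / (fact M * fact N * fact K))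
      \<le> (case p of (M, N, K) \<Rightarrow> (C1 * C2 * C3) * (x ^ M * y ^ N * z ^ K / (fact M * fact N * fact K)))"
      by (simp add: p power3_eq_cube mult_ac)
  qed
  also have "\<dots> = (C1 * C2 * C3) * (\<Sum>(M, N, K)\<in>triples T. x ^ M * y ^ N * z ^ K / (fact M * fact N * fact K))"
    by (simp add: sum_distrib_left split_def)
  finally show ?thesis by (simp add: multinomial_triples)
qed

text \<open>The shifted Lauricella series are summed by total
  degree, and the shift by \<open>s\<close> moves into the binomial coefficient.  The value of the sum, \<open>g s\<close>, is the Taylor
  coefficient of order \<open>s\<close> at \<open>u = 1\<close> of \<open>u \<mapsto> F\<^sub>A(u x, u y, u z)\<close>.\<close>

lemma shifted_lauricella_sum:
  assumes nn: "0 \<le> x" "0 \<le> y" "0 \<le> z" "x + y + z < 1" "0 \<le> C1" "0 \<le> C2" "0 \<le> C3"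
    and B: "\<And>M. norm (B1 M) \<le> C1 * x ^ M" "\<And>M. norm (B2 M) \<le> C2 * y ^ M" "\<And>M. norm (B3 M) \<le> C3 * z ^ M"
  shows "((\<lambda>T. of_nat (T choose s) * (pochhammer a T * hom_coeff B1 B2 B3 T)) has_sum
      pochhammer a s * (\<Sum>(i, j, k)\<in>triples s. (\<Sum>\<^sub>\<infinity>p. lauricella_term (a + of_nat s)
            (\<lambda>M. B1 (i + M)) (\<lambda>N. B2 (j + N)) (\<lambda>K. B3 (k + K)) p) / (fact i * fact j * fact k))) UNIV"
    (is "(_ has_sum pochhammer a s * ?S) _")
proof -
  have "((\<lambda>T. \<Sum>(i, j, k)\<in>triples s. pochhammer (a + of_nat s) T *
          hom_coeff (\<lambda>M. B1 (i + M)) (\<lambda>N. B2 (j + N)) (\<lambda>K. B3 (k + K)) T / (fact i * fact j * fact k))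
        has_sum ?S) UNIV"
  proof (rule has_sum_finite_sum[OF finite_triples])
    fix q assume "q \<in> triples s"
    obtain i j k where q: "q = (i, j, k)" by (cases q)
    have "((\<lambda>T. pochhammer (a + of_nat s) T *
          hom_coeff (\<lambda>M. B1 (i + M)) (\<lambda>N. B2 (j + N)) (\<lambda>K. B3 (k + K)) T) has_sum
        (\<Sum>\<^sub>\<infinity>p. lauricella_term (a + of_nat s) (\<lambda>M. B1 (i + M)) (\<lambda>N. B2 (j + N)) (\<lambda>K. B3 (k + K)) p)) UNIV"
      by (rule lauricella_by_degree[OF order_refl nn]; rule shifted_bound) (use nn B in auto)
    from has_sum_divide_const[OF this, of "fact i * fact j * fact k"]
    show "((\<lambda>T. case q of (i, j, k) \<Rightarrow> pochhammer (a + of_nat s) T *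
          hom_coeff (\<lambda>M. B1 (i + M)) (\<lambda>N. B2 (j + N)) (\<lambda>K. B3 (k + K)) T / (fact i * fact j * fact k))
        has_sum (case q of (i, j, k) \<Rightarrow> (\<Sum>\<^sub>\<infinity>p. lauricella_term (a + of_nat s)
            (\<lambda>M. B1 (i + M)) (\<lambda>N. B2 (j + N)) (\<lambda>K. B3 (k + K)) p) / (fact i * fact j * fact k))) UNIV"
      by (simp add: q)
  qed
  also have "(\<lambda>T. \<Sum>(i, j, k)\<in>triples s. pochhammer (a + of_nat s) T *
          hom_coeff (\<lambda>M. B1 (i + M)) (\<lambda>N. B2 (j + N)) (\<lambda>K. B3 (k + K)) T / (fact i * fact j * fact k))
      = (\<lambda>T. pochhammer (a + of_nat s) T * (of_nat ((T + s) choose s) * hom_coeff B1 B2 B3 (T + s)))"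
    unfolding hom_coeff_shift[symmetric] by (simp add: sum_distrib_left split_def)
  finally have "((\<lambda>T. pochhammer a s * (pochhammer (a + of_nat s) T *
      (of_nat ((T + s) choose s) * hom_coeff B1 B2 B3 (T + s)))) has_sum pochhammer a s * ?S) UNIV"
    by (rule has_sum_cmult_right)
  also have "?this \<longleftrightarrow> ((\<lambda>T. of_nat (T choose s) * (pochhammer a T * hom_coeff B1 B2 B3 T)) has_sum
      pochhammer a s * ?S) {s..}"
    by (rule has_sum_reindex_bij_witness[of _ "\<lambda>T. T - s" "\<lambda>T. T + s"])
       (auto simp: pochhammer_product'[of a s] add.commute[of _ s])
  also have "\<dots> \<longleftrightarrow> ((\<lambda>T. of_nat (T choose s) * (pochhammer a T * hom_coeff B1 B2 B3 T)) has_sum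
      pochhammer a s * ?S) UNIV"
    by (rule has_sum_cong_neutral) auto
  finally show ?thesis .
qed

section \<open>Resummation of a binomial transform\<close>

text \<open>Continuity on the closed disc is part of the conclusion, because the value at the boundary point
  \<open>1\<close> of the unit disc is what is needed below.\<close>

lemma series_holomorphic_on_ball:
  fixes f :: "nat \<Rightarrow> complex \<Rightarrow> complex"
  assumes "\<And>n. f n holomorphic_on UNIV" "\<And>n x. x \<in> cball z r \<Longrightarrow> norm (f n x) \<le> M n" "summable M"
  shows "continuous_on (cball z r) (\<lambda>x. \<Sum>n. f n x)" "(\<lambda>x. \<Sum>n. f n x) holomorphic_on ball z r"
proof -
  have "uniform_limit (cball z r) (\<lambda>n x. \<Sum>i<n. f i x) (\<lambda>x. \<Sum>i. f i x) sequentially"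
    by (rule Weierstrass_m_test) (use assms in auto)
  moreover have "(\<lambda>x. \<Sum>i<n. f i x) holomorphic_on UNIV" for n
    by (intro holomorphic_intros assms)
  hence "continuous_on (cball z r) (\<lambda>x. \<Sum>i<n. f i x) \<and> (\<lambda>x. \<Sum>i<n. f i x) holomorphic_on ball z r" for n
    by (meson holomorphic_on_imp_continuous_on holomorphic_on_subset subset_UNIV)
  ultimately show "continuous_on (cball z r) (\<lambda>x. \<Sum>n. f n x)" "(\<lambda>x. \<Sum>n. f n x) holomorphic_on ball z r"
    using holomorphic_uniform_limit[of z r "\<lambda>n x. \<Sum>i<n. f i x" sequentially "\<lambda>x. \<Sum>n. f n x"]
    by auto
qed

definition binomial_transform :: "(nat \<Rightarrow> complex) \<Rightarrow> nat \<Rightarrow> complex \<Rightarrow> complex" where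
  "binomial_transform \<mu> T \<zeta> = (\<Sum>s\<le>T. of_nat (T choose s) * (- \<zeta>) ^ s * \<mu> s)"

text \<open>Interchanging the two sums is not a matter of absolute convergence: the hypothesis \<open>summable\<close> concerns
  the numbers \<open>\<mu> s * g s\<close>, after the sum over \<open>T\<close> inside \<open>g s\<close> has been formed.  Weighting the
  term of index \<open>s\<close> by \<open>\<zeta>\<^sup>s\<close> makes the interchange legitimate for small \<open>\<zeta>\<close>, and analytic
  continuation carries the equality along the segment to \<open>\<zeta> = 1\<close>.  The bound on the transform in a disc around
  \<open>1\<close> of radius greater than \<open>1\<close> is what allows the continuation, as that disc contains
  the whole segment from \<open>0\<close> to \<open>1\<close> in its interior.\<close>

lemma binomial_resummation:
  fixes f \<mu> g :: "nat \<Rightarrow> complex" and C D \<rho> \<sigma> r :: real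
  assumes f: "\<And>T. norm (f T) \<le> C * \<rho> ^ T" and \<rho>: "0 \<le> \<rho>" "\<rho> < 1"
    and g: "\<And>s. ((\<lambda>T. of_nat (T choose s) * f T) has_sum g s) UNIV"
    and \<mu>: "\<And>s. norm (\<mu> s) \<le> D * 2 ^ s"
    and L: "\<And>T \<zeta>. norm (1 - \<zeta>) \<le> r \<Longrightarrow> norm (binomial_transform \<mu> T \<zeta>) \<le> E * \<sigma> ^ T"
    and r: "r > 1" and \<sigma>: "0 \<le> \<sigma>" "\<sigma> * \<rho> < 1"
    and summable: "(\<lambda>s. norm (\<mu> s * g s)) summable_on UNIV"
  shows "(\<Sum>\<^sub>\<infinity>s. (- 1) ^ s * \<mu> s * g s) = (\<Sum>T. f T * binomial_transform \<mu> T 1)"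
proof -
  define P where "P \<zeta> = (\<Sum>s. (- \<zeta>) ^ s * \<mu> s * g s)" for \<zeta>
  define Q where "Q \<zeta> = (\<Sum>T. f T * binomial_transform \<mu> T \<zeta>)" for \<zeta>
  have C: "0 \<le> C" using order_trans[OF norm_ge_zero f[of 0]] by simp
  have D: "0 \<le> D" using order_trans[OF norm_ge_zero \<mu>[of 0]] by simp
  have sumP: "summable (\<lambda>s. norm (\<mu> s * g s))"
    using summable by (rule summable_on_imp_summable)
  have boundP: "norm ((- \<zeta>) ^ s * \<mu> s * g s) \<le> norm (\<mu> s * g s)" if "\<zeta> \<in> cball 0 1" for \<zeta> s
  proof -
    have "norm ((- \<zeta>) ^ s) * norm (\<mu> s * g s) \<le> 1 * norm (\<mu> s * g s)"
      using that by (intro mult_right_mono) (auto simp: norm_power intro: power_le_one)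
    thus ?thesis by (simp add: norm_mult mult_ac)
  qed
  have holP: "(\<lambda>\<zeta>. (- \<zeta>) ^ s * \<mu> s * g s) holomorphic_on UNIV" for s
    by (intro holomorphic_intros)
  have P: "continuous_on (cball 0 1) P" "P holomorphic_on ball 0 1"
    unfolding P_def
    by (rule series_holomorphic_on_ball[OF holP boundP sumP]; assumption)+
  have boundQ: "norm (f T * binomial_transform \<mu> T \<zeta>) \<le> (C * E) * (\<sigma> * \<rho>) ^ T"
    if "\<zeta> \<in> cball 1 r" for \<zeta> T
  proof -
    have "norm (f T * binomial_transform \<mu> T \<zeta>) \<le> (C * \<rho> ^ T) * (E * \<sigma> ^ T)"
      unfolding norm_mult using that C \<rho> by (intro mult_mono f L) (auto simp: dist_norm)
    thus ?thesis by (simp add: power_mult_distrib mult_ac)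
  qed
  have sumQ: "summable (\<lambda>T. (C * E) * (\<sigma> * \<rho>) ^ T)"
    using \<rho> \<sigma> by (intro summable_mult summable_geometric) auto
  have holQ: "(\<lambda>\<zeta>. f T * binomial_transform \<mu> T \<zeta>) holomorphic_on UNIV" for T
    unfolding binomial_transform_def by (intro holomorphic_intros)
  have Q: "continuous_on (cball 1 r) Q" "Q holomorphic_on ball 1 r"
    unfolding Q_def
    by (rule series_holomorphic_on_ball[OF holQ boundQ sumQ]; assumption)+
  \<comment> \<open>small enough for the double series to converge absolutely when \<open>\<bar>\<zeta>\<bar> < \<delta>\<close>, given \<open>\<bar>\<mu> s\<bar> \<le> D 2\<^sup>s\<close>\<close>
  define \<delta> where "\<delta> = (1 - \<rho>) / 4"
  have \<delta>: "0 < \<delta>" "\<delta> < 1" "\<rho> * (1 + 2 * \<delta>) < 1"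
  proof -
    show "0 < \<delta>" "\<delta> < 1" using \<rho> by (auto simp: \<delta>_def)
    have "1 - \<rho> * (1 + 2 * \<delta>) = (1 - \<rho>) * (1 - \<rho> / 2)" by (simp add: \<delta>_def field_simps)
    also have "\<dots> > 0" using \<rho> by (intro mult_pos_pos) auto
    finally show "\<rho> * (1 + 2 * \<delta>) < 1" by simp
  qed
  have near: "P \<zeta> = Q \<zeta>" if "norm \<zeta> < \<delta>" for \<zeta>
  proof -
    define F where "F = (\<lambda>(T, s). f T * (of_nat (T choose s) * (- \<zeta>) ^ s * \<mu> s))"
    define q where "q = \<rho> * (1 + 2 * norm \<zeta>)"
    have q: "0 \<le> q" "q < 1"
    proof -
      show "0 \<le> q" using \<rho> by (simp add: q_def)
      have "q \<le> \<rho> * (1 + 2 * \<delta>)" unfolding q_def using \<rho> that by (intro mult_left_mono) auto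
      thus "q < 1" using \<delta> by simp
    qed
    have fibre: "((\<lambda>s. h s * of_nat (T choose s)) has_sum (\<Sum>s\<le>T. h s * of_nat (T choose s))) UNIV"
      for h :: "nat \<Rightarrow> 'b::{real_normed_field}" and T
    proof -
      have "((\<lambda>s. h s * of_nat (T choose s)) has_sum (\<Sum>s\<le>T. h s * of_nat (T choose s))) {..T}"
        by (rule has_sum_finite) auto
      thus ?thesis by (subst has_sum_cong_neutral[of "{..T}" UNIV]) auto
    qed
    have "(\<lambda>p. norm (F p)) summable_on UNIV \<times> UNIV"
    proof (rule summable_on_SigmaI)
      show "((\<lambda>s. norm (F (T, s))) has_sum
          (\<Sum>s\<le>T. norm (f T) * norm \<zeta> ^ s * norm (\<mu> s) * of_nat (T choose s))) UNIV" for T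
        using fibre[of "\<lambda>s. norm (f T) * norm \<zeta> ^ s * norm (\<mu> s)" T]
        by (simp add: F_def norm_mult norm_power mult_ac)
      have le: "(\<Sum>s\<le>T. norm (f T) * norm \<zeta> ^ s * norm (\<mu> s) * of_nat (T choose s)) \<le> C * D * q ^ T" for T
      proof -
        have "(\<Sum>s\<le>T. norm (f T) * norm \<zeta> ^ s * norm (\<mu> s) * of_nat (T choose s))
            \<le> (\<Sum>s\<le>T. (C * \<rho> ^ T) * norm \<zeta> ^ s * (D * 2 ^ s) * of_nat (T choose s))"
          using C D \<rho> by (intro sum_mono mult_mono f \<mu>) auto
        also have "\<dots> = C * D * \<rho> ^ T * (\<Sum>s\<le>T. of_nat (T choose s) * (2 * norm \<zeta>) ^ s * 1 ^ (T - s))"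
          unfolding sum_distrib_left by (intro sum.cong) (auto simp: power_mult_distrib)
        also have "\<dots> = C * D * q ^ T"
          unfolding binomial_ring[symmetric] q_def by (simp add: power_mult_distrib add.commute)
        finally show ?thesis .
      qed
      have "(\<lambda>T. C * D * q ^ T) summable_on UNIV"
      proof (rule summable_nonneg_imp_summable_on)
        show "summable (\<lambda>T. C * D * q ^ T)"
          using q by (intro summable_mult summable_geometric) auto
      qed (use q C D in auto)
      thus "(\<lambda>T. \<Sum>s\<le>T. norm (f T) * norm \<zeta> ^ s * norm (\<mu> s) * of_nat (T choose s))
          summable_on UNIV"
        by (rule summable_on_comparison_test[OF _ le]) (auto intro!: sum_nonneg)
    qed auto
    hence F: "(F has_sum (\<Sum>\<^sub>\<infinity>p. F p)) (UNIV \<times> UNIV)"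
      using has_sum_infsum[OF abs_summable_summable[of F "UNIV \<times> UNIV"]] by simp
    have "((\<lambda>T. f T * binomial_transform \<mu> T \<zeta>) has_sum (\<Sum>\<^sub>\<infinity>p. F p)) UNIV"
    proof (rule has_sum_SigmaD[OF F])
      show "((\<lambda>s. F (T, s)) has_sum f T * binomial_transform \<mu> T \<zeta>) UNIV" for T
        using has_sum_cmult_right[OF fibre[of "\<lambda>s. (- \<zeta>) ^ s * \<mu> s" T], of "f T"]
        by (simp add: F_def binomial_transform_def mult_ac)
    qed
    hence 1: "Q \<zeta> = (\<Sum>\<^sub>\<infinity>p. F p)"
      unfolding Q_def by (metis has_sum_imp_sums sums_unique)
    have "((\<lambda>s. (- \<zeta>) ^ s * \<mu> s * g s) has_sum (\<Sum>\<^sub>\<infinity>p. F p)) UNIV"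
    proof (rule has_sum_SigmaD)
      show "((\<lambda>(s, T). F (T, s)) has_sum (\<Sum>\<^sub>\<infinity>p. F p)) (UNIV \<times> UNIV)"
        using F by (subst (asm) has_sum_swap)
      show "((\<lambda>T. case (s, T) of (s, T) \<Rightarrow> F (T, s)) has_sum (- \<zeta>) ^ s * \<mu> s * g s) UNIV" for s
        using has_sum_cmult_right[OF g[of s], of "(- \<zeta>) ^ s * \<mu> s"]
        by (simp add: F_def mult_ac)
    qed
    hence 2: "P \<zeta> = (\<Sum>\<^sub>\<infinity>p. F p)"
      unfolding P_def by (metis has_sum_imp_sums sums_unique)
    show ?thesis using 1 2 by simp
  qed
  have inner: "P \<zeta> = Q \<zeta>" if "\<zeta> \<in> ball 0 1 \<inter> ball 1 r" for \<zeta>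
  proof (rule analytic_continuation_open[of "ball 0 \<delta> \<inter> ball 1 r" "ball 0 1 \<inter> ball 1 r" P Q])
    have "0 \<in> ball 0 \<delta> \<inter> ball (1::complex) r" using \<delta> r by simp
    thus "ball 0 \<delta> \<inter> ball (1::complex) r \<noteq> {}" by blast
    show "connected (ball 0 1 \<inter> ball (1::complex) r)"
      by (intro convex_connected convex_Int convex_ball)
    show "ball 0 \<delta> \<inter> ball 1 r \<subseteq> ball 0 1 \<inter> ball (1::complex) r" using \<delta> by auto
    show "P holomorphic_on ball 0 1 \<inter> ball 1 r" using P(2) by (rule holomorphic_on_subset) auto
    show "Q holomorphic_on ball 0 1 \<inter> ball 1 r" using Q(2) by (rule holomorphic_on_subset) auto
    show "P z = Q z" if "z \<in> ball 0 \<delta> \<inter> ball 1 r" for z using near that by simp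
  qed (use that in auto)
  \<comment> \<open>the value at the boundary point \<open>1\<close> is reached along the radius\<close>
  define w :: "nat \<Rightarrow> complex" where "w n = of_real (1 - inverse (real (Suc n)))" for n
  have w: "w n \<in> ball 0 1 \<inter> ball 1 r" for n
  proof -
    define e where "e = inverse (real (Suc n))"
    have e: "0 < e" "e \<le> 1" by (simp_all add: e_def inverse_le_1_iff)
    have we: "w n = of_real (1 - e)" "1 - w n = of_real e" by (simp_all add: w_def e_def)
    have "norm (w n) < 1" unfolding we norm_of_real using e by simp
    moreover have "norm (1 - w n) < r" unfolding we norm_of_real using e r by simp
    ultimately show ?thesis by (simp add: dist_norm)
  qed
  have "(\<lambda>n. 1 - inverse (real (Suc n))) \<longlonglongrightarrow> 1 - 0"
    by (intro tendsto_intros LIMSEQ_inverse_real_of_nat)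
  hence "(\<lambda>n. complex_of_real (1 - inverse (real (Suc n)))) \<longlonglongrightarrow> of_real (1 - 0)"
    by (rule tendsto_of_real)
  hence lim: "w \<longlonglongrightarrow> 1"
    unfolding w_def by (simp only: diff_zero of_real_1)
  have wP: "w n \<in> cball 0 1" and wQ: "w n \<in> cball 1 r" for n
    using w[of n] ball_subset_cball by blast+
  have "(\<lambda>n. P (w n)) \<longlonglongrightarrow> P 1"
    by (rule continuous_on_tendsto_compose[OF P(1) lim]) (use wP in \<open>auto intro!: always_eventually\<close>)
  moreover have "(\<lambda>n. Q (w n)) \<longlonglongrightarrow> Q 1"
    by (rule continuous_on_tendsto_compose[OF Q(1) lim]) (use wQ r in \<open>auto intro!: always_eventually\<close>)
  ultimately have "P 1 = Q 1"
    unfolding inner[OF w] by (rule LIMSEQ_unique)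
  moreover have "((\<lambda>s. (- 1) ^ s * \<mu> s * g s) has_sum (\<Sum>\<^sub>\<infinity>s. (- 1) ^ s * \<mu> s * g s)) UNIV"
  proof (rule has_sum_infsum, rule abs_summable_summable)
    show "(\<lambda>s. norm ((- 1) ^ s * \<mu> s * g s)) summable_on UNIV"
      using summable by (simp add: norm_mult norm_power)
  qed
  hence "(\<Sum>\<^sub>\<infinity>s. (- 1) ^ s * \<mu> s * g s) = P 1"
    unfolding P_def by (metis has_sum_imp_sums sums_unique)
  ultimately show ?thesis by (simp add: Q_def)
qed

section \<open>The coefficients of 0F1 and their moments\<close>

text \<open>The coefficients of \<open>0F1(1 - a; - t)\<close>.\<close>

definition coeff_0F1 :: "complex \<Rightarrow> complex \<Rightarrow> nat \<Rightarrow> complex" where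
  "coeff_0F1 a t p = (- t) ^ p / (pochhammer (1 - a) p * fact p)"

text \<open>The factor to which the sum over \<open>q\<close> in the expansion reduces.\<close>

definition coeff_moment :: "complex \<Rightarrow> complex \<Rightarrow> nat \<Rightarrow> complex" where
  "coeff_moment a t s = (\<Sum>\<^sub>\<infinity>p. coeff_0F1 a t p * pochhammer (of_nat p) s)"

text \<open>The reflection \<open>\<zeta> \<mapsto> 1 - \<zeta>\<close> of a terminating Gauss series \<open>F(- T, p; a; \<zeta>)\<close>.  On the left the terms
  alternate and cancel strongly near \<open>\<zeta> = 1\<close>; on the right nothing has to cancel for
  \<open>\<bar>1 - \<zeta>\<bar> \<le> 1\<close>, so term-by-term estimates suffice.\<close>

lemma binomial_reflection:
  fixes a p \<zeta> :: "'a::field_char_0"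
  assumes nz: "pochhammer a T \<noteq> 0"
  shows "(\<Sum>s\<le>T. of_nat (T choose s) * (- \<zeta>) ^ s * (pochhammer p s / pochhammer a s))
       = (\<Sum>j\<le>T. of_nat (T choose j) * pochhammer p j * pochhammer (a - p) (T - j)
            / pochhammer a T * (1 - \<zeta>) ^ j)"
proof -
  define w where "w j = of_nat (T choose j) * pochhammer p j * pochhammer (a - p) (T - j)
            / pochhammer a T" for j
  have inner: "(\<Sum>i\<le>T - s. w (s + i) * of_nat ((s + i) choose s))
      = of_nat (T choose s) * (pochhammer p s / pochhammer a s)" if s: "s \<le> T" for s
  proof -
    have T: "pochhammer a T = pochhammer a s * pochhammer (a + of_nat s) (T - s)"
      using pochhammer_product[OF s, of a] .
    have "(\<Sum>i\<le>T - s. w (s + i) * of_nat ((s + i) choose s))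
      = (\<Sum>i\<le>T - s. of_nat (T choose s) * pochhammer p s / pochhammer a T
          * (of_nat ((T - s) choose i) * pochhammer (p + of_nat s) i * pochhammer (a - p) (T - s - i)))"
    proof (intro sum.cong refl, goal_cases)
      case (1 i)
      hence "(T choose (s + i)) * ((s + i) choose s) = (T choose s) * ((T - s) choose i)"
        using choose_mult[of s "s + i" T] s by simp
      hence "of_nat (T choose (s + i)) * of_nat ((s + i) choose s)
          = (of_nat (T choose s) * of_nat ((T - s) choose i) :: 'a)"
        by (metis of_nat_mult)
      note ch = this
      have "w (s + i) * of_nat ((s + i) choose s)
          = (of_nat (T choose (s + i)) * of_nat ((s + i) choose s)) * pochhammer p (s + i)
            * pochhammer (a - p) (T - (s + i)) / pochhammer a T"
        unfolding w_def by simp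
      thus ?case
        unfolding ch pochhammer_product'[of p s i] by (simp add: mult_ac)
    qed
    also have "\<dots> = of_nat (T choose s) * pochhammer p s / pochhammer a T
        * pochhammer ((p + of_nat s) + (a - p)) (T - s)"
      unfolding pochhammer_binomial_sum sum_distrib_left ..
    also have "(p + of_nat s) + (a - p) = a + of_nat s" by simp
    finally show ?thesis using nz unfolding T by simp
  qed
  have "(\<Sum>j\<le>T. w j * (1 - \<zeta>) ^ j) = (\<Sum>j\<le>T. w j * (- \<zeta> + 1) ^ j)"
    by simp
  also have "\<dots> = (\<Sum>j\<le>T. \<Sum>s\<le>j. w j * of_nat (j choose s) * (- \<zeta>) ^ s)"
    unfolding binomial_ring by (simp add: sum_distrib_left mult_ac)
  also have "\<dots> = (\<Sum>(j, s)\<in>Sigma {..T} (\<lambda>j. {..j}). w j * of_nat (j choose s) * (- \<zeta>) ^ s)"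
    by (simp add: sum.Sigma)
  also have "\<dots> = (\<Sum>(s, i)\<in>Sigma {..T} (\<lambda>s. {..T - s}). w (s + i) * of_nat ((s + i) choose s) * (- \<zeta>) ^ s)"
    by (rule sum.reindex_bij_witness[of _ "\<lambda>(s, i). (s + i, s)" "\<lambda>(j, s). (s, j - s)"]) auto
  also have "\<dots> = (\<Sum>s\<le>T. (\<Sum>i\<le>T - s. w (s + i) * of_nat ((s + i) choose s)) * (- \<zeta>) ^ s)"
    by (simp add: sum.Sigma sum_distrib_right)
  also have "\<dots> = (\<Sum>s\<le>T. of_nat (T choose s) * (- \<zeta>) ^ s * (pochhammer p s / pochhammer a s))"
    by (intro sum.cong refl, subst inner) (auto simp: mult_ac)
  finally show ?thesis by (simp add: w_def)
qed

lemma one_minus_not_nonpos_Int: "a \<notin> \<int> \<Longrightarrow> 1 - (a::complex) \<notin> \<int>\<^sub>\<le>\<^sub>0"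
  using nonpos_Ints_Int[of "1 - a"] Ints_diff[of 1 "1 - a"] by auto

lemma pochhammer_nonzero: "a \<notin> \<int>\<^sub>\<le>\<^sub>0 \<Longrightarrow> pochhammer (a::complex) n \<noteq> 0"
  by (auto simp: pochhammer_eq_0_iff)

context
  fixes a t :: complex
  assumes a: "a \<notin> \<int>"
begin

lemma a_not_nonpos: "a \<notin> \<int>\<^sub>\<le>\<^sub>0"
  using a nonpos_Ints_Int by blast

lemma pochhammer_a_nonzero: "pochhammer a n \<noteq> 0" "pochhammer (1 - a) n \<noteq> 0"
  using pochhammer_nonzero a_not_nonpos one_minus_not_nonpos_Int[OF a] by auto

lemma coeff_majorant:
  assumes "0 \<le> L"
  shows "(\<lambda>p. norm (coeff_0F1 a t p) * L ^ p) summable_on UNIV"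
proof -
  obtain D where D: "D > 0" "\<And>n. norm (pochhammer 1 n / pochhammer (1 - a) n) \<le> D * 2 ^ n"
    using pochhammer_ratio_bound[OF one_minus_not_nonpos_Int[OF a], of 2 1] by auto
  have "summable (\<lambda>p. D * (inverse (fact p) * (2 * norm t * L) ^ p))"
    by (intro summable_mult summable_exp)
  hence "(\<lambda>p. D * (inverse (fact p) * (2 * norm t * L) ^ p)) summable_on UNIV"
    by (rule summable_nonneg_imp_summable_on) (use D assms in auto)
  thus ?thesis
  proof (rule summable_on_comparison_test)
    fix p :: nat
    have "norm (coeff_0F1 a t p) * L ^ p
        = norm (pochhammer 1 p / pochhammer (1 - a) p) * ((norm t * L) ^ p / (fact p * fact p))"
      by (simp add: coeff_0F1_def norm_mult norm_divide norm_power power_mult_distrib pochhammer_fact[symmetric])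
    also have "\<dots> \<le> (D * 2 ^ p) * ((norm t * L) ^ p / (fact p * 1))"
      using assms D by (intro mult_mono D divide_left_mono) (auto simp: fact_ge_1)
    also have "\<dots> = D * (inverse (fact p) * (2 * norm t * L) ^ p)"
      by (simp add: power_mult_distrib field_simps)
    finally show "norm (coeff_0F1 a t p) * L ^ p \<le> D * (inverse (fact p) * (2 * norm t * L) ^ p)" .
  qed (use assms in auto)
qed

lemma coeff_powr_summable:
  assumes "0 < v" "v < 1"
  shows "(\<lambda>p. norm (coeff_0F1 a t p) * v powr (- (2 * of_nat p + \<alpha>))) summable_on UNIV"
proof -
  have "v powr (- (2 * of_nat p + \<alpha>)) = (v powr (- 2)) ^ p * v powr (- \<alpha>)" for p
  proof -
    have "v powr (- (2 * of_nat p + \<alpha>)) = v powr ((- 2) * of_nat p + (- \<alpha>))"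
      by (rule arg_cong[of _ _ "\<lambda>e. v powr e"]) simp
    also have "\<dots> = (v powr (- 2)) powr (of_nat p) * v powr (- \<alpha>)"
      unfolding powr_add powr_powr ..
    also have "(v powr (- 2)) powr (of_nat p) = (v powr (- 2)) ^ p"
      by (rule powr_realpow) (use assms in simp)
    finally show ?thesis .
  qed
  hence "(\<lambda>p. norm (coeff_0F1 a t p) * v powr (- (2 * of_nat p + \<alpha>)))
      = (\<lambda>p. norm (coeff_0F1 a t p) * (v powr (- 2)) ^ p * v powr (- \<alpha>))"
    by (simp add: mult.assoc)
  moreover have "(\<lambda>p. norm (coeff_0F1 a t p) * (v powr (- 2)) ^ p * v powr (- \<alpha>)) summable_on UNIV"
    by (intro summable_on_cmult_left coeff_majorant) auto
  ultimately show ?thesis by simp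
qed

text \<open>The denominator \<open>(1 - a)\<^sub>p p!\<close> makes \<open>coeff_0F1\<close> decay faster than every geometric sequence.  Hence it
  is enough to bound \<open>(\<beta>)\<^sub>T / T!\<close> by \<open>q\<^sup>T\<close> times an exponential in \<open>\<beta> = 2 p + \<alpha>\<close>, and the binomial series
  does this: one term is at most the whole sum.  The parameter \<open>2 p + \<alpha>\<close> covers both uses below, \<open>(p)\<^sub>s\<close>
  and the product of \<open>(p)\<^sub>j\<close> with \<open>(a - p)\<^sub>T\<^sub>-\<^sub>j\<close> summed over \<open>j\<close>.\<close>

lemma coeff_growth:
  assumes "0 \<le> \<alpha>" "1 < q"
  shows "\<exists>D>0. \<forall>T. (\<lambda>p. norm (coeff_0F1 a t p) * pochhammer (2 * of_nat p + \<alpha>) T) summable_on UNIV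
     \<and> (\<Sum>\<^sub>\<infinity>p. norm (coeff_0F1 a t p) * pochhammer (2 * of_nat p + \<alpha>) T) \<le> D * q ^ T * fact T"
proof -
  \<comment> \<open>\<open>1 - v = 1 / q\<close> is the point at which the binomial series is evaluated\<close>
  define v where "v = 1 - 1 / q"
  have v: "0 < v" "v < 1" using assms by (auto simp: v_def)
  define S where "S = (\<Sum>\<^sub>\<infinity>p. norm (coeff_0F1 a t p) * v powr (- (2 * of_nat p + \<alpha>)))"
  have S: "((\<lambda>p. norm (coeff_0F1 a t p) * v powr (- (2 * of_nat p + \<alpha>))) has_sum S) UNIV"
    unfolding S_def using coeff_powr_summable[OF v] by (rule has_sum_infsum)
  have "0 \<le> S" unfolding S_def by (intro infsum_nonneg) auto
  have le: "pochhammer \<beta> T \<le> q ^ T * fact T * v powr (- \<beta>)" if "0 \<le> \<beta>" for \<beta> :: real and T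
  proof -
    have "pochhammer \<beta> T / fact T * (1 / q) ^ T \<le> (1 - 1 / q) powr (- \<beta>)"
    proof (rule has_sum_mono')
      show "((\<lambda>n. pochhammer \<beta> n / fact n * (1 / q) ^ n) has_sum (1 - 1 / q) powr (- \<beta>)) UNIV"
        using that assms by (intro binomial_series_has_sum) auto
      show "((\<lambda>n. pochhammer \<beta> n / fact n * (1 / q) ^ n) has_sum
          pochhammer \<beta> T / fact T * (1 / q) ^ T) {T}"
        by (rule has_sum_finiteI) auto
      show "0 \<le> pochhammer \<beta> n / fact n * (1 / q) ^ n" for n
        using that assms by (auto intro!: mult_nonneg_nonneg divide_nonneg_nonneg pochhammer_nonneg_real)
    qed auto
    thus ?thesis using assms(2) by (simp add: v_def field_simps)
  qed
  have maj: "((\<lambda>p. q ^ T * fact T * (norm (coeff_0F1 a t p) * v powr (- (2 * of_nat p + \<alpha>)))) has_sum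
      q ^ T * fact T * S) UNIV" for T
    using S by (rule has_sum_cmult_right)
  have term_le: "norm (coeff_0F1 a t p) * pochhammer (2 * of_nat p + \<alpha>) T
      \<le> q ^ T * fact T * (norm (coeff_0F1 a t p) * v powr (- (2 * of_nat p + \<alpha>)))" for p T
  proof -
    have "norm (coeff_0F1 a t p) * pochhammer (2 * of_nat p + \<alpha>) T
        \<le> norm (coeff_0F1 a t p) * (q ^ T * fact T * v powr (- (2 * of_nat p + \<alpha>)))"
      using assms by (intro mult_left_mono le) auto
    thus ?thesis by (simp only: mult_ac)
  qed
  have sm: "(\<lambda>p. norm (coeff_0F1 a t p) * pochhammer (2 * of_nat p + \<alpha>) T) summable_on UNIV" for T
    by (rule summable_on_comparison_test[OF has_sum_imp_summable[OF maj[of T]] term_le])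
       (use assms in \<open>auto intro!: mult_nonneg_nonneg pochhammer_nonneg_real\<close>)
  have "(\<Sum>\<^sub>\<infinity>p. norm (coeff_0F1 a t p) * pochhammer (2 * of_nat p + \<alpha>) T) \<le> (S + 1) * q ^ T * fact T" for T
  proof -
    have "(\<Sum>\<^sub>\<infinity>p. norm (coeff_0F1 a t p) * pochhammer (2 * of_nat p + \<alpha>) T) \<le> q ^ T * fact T * S"
      by (rule has_sum_mono[OF has_sum_infsum[OF sm] maj term_le])
    also have "\<dots> \<le> q ^ T * fact T * (S + 1)" using assms by (intro mult_left_mono) auto
    finally show ?thesis by (simp only: mult_ac)
  qed
  thus ?thesis using sm \<open>0 \<le> S\<close> by (intro exI[of _ "S + 1"]) auto
qed

lemma coeff_pochhammer_abs_summable: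
  assumes "0 \<le> \<alpha>" "\<And>p. norm (w p) \<le> c * pochhammer (2 * of_nat p + \<alpha>) T"
  shows "(\<lambda>p. coeff_0F1 a t p * w p) abs_summable_on UNIV"
proof (rule Infinite_Sum.abs_summable_on_comparison_test')
  show "(\<lambda>p. c * (norm (coeff_0F1 a t p) * pochhammer (2 * of_nat p + \<alpha>) T)) summable_on UNIV"
    using coeff_growth[OF assms(1), of 2] by (intro summable_on_cmult_right) auto
  fix p
  have "norm (coeff_0F1 a t p) * norm (w p) \<le> norm (coeff_0F1 a t p) * (c * pochhammer (2 * of_nat p + \<alpha>) T)"
    by (intro mult_left_mono assms) auto
  thus "norm (coeff_0F1 a t p * w p) \<le> c * (norm (coeff_0F1 a t p) * pochhammer (2 * of_nat p + \<alpha>) T)"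
    by (simp add: norm_mult mult_ac)
qed

lemma norm_pochhammer_of_nat_le: "norm (pochhammer (of_nat p :: complex) s) \<le> pochhammer (2 * of_nat p + 0) s"
  by (rule norm_pochhammer_le) simp

lemma coeff_moment_has_sum:
  "((\<lambda>p. coeff_0F1 a t p * pochhammer (of_nat p) s) has_sum coeff_moment a t s) UNIV"
  unfolding coeff_moment_def
  by (rule has_sum_infsum[OF abs_summable_summable],
      rule coeff_pochhammer_abs_summable[of 0 _ 1 s]) (use norm_pochhammer_of_nat_le in auto)

lemma norm_coeff_sum_le:
  assumes "0 \<le> \<alpha>" "\<And>p. norm (w p) \<le> c * pochhammer (2 * of_nat p + \<alpha>) T"
    "((\<lambda>p. coeff_0F1 a t p * w p) has_sum S) UNIV"
  shows "norm S \<le> c * (\<Sum>\<^sub>\<infinity>p. norm (coeff_0F1 a t p) * pochhammer (2 * of_nat p + \<alpha>) T)"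
proof -
  have sm: "(\<lambda>p. norm (coeff_0F1 a t p) * pochhammer (2 * of_nat p + \<alpha>) T) summable_on UNIV"
    using coeff_growth[OF assms(1), of 2] by auto
  have abs: "(\<lambda>p. coeff_0F1 a t p * w p) abs_summable_on UNIV"
    by (rule coeff_pochhammer_abs_summable[OF assms(1,2)])
  have "norm S \<le> (\<Sum>\<^sub>\<infinity>p. norm (coeff_0F1 a t p * w p))"
    using norm_infsum_bound[OF abs] infsumI[OF assms(3)] by simp
  also have "\<dots> \<le> c * (\<Sum>\<^sub>\<infinity>p. norm (coeff_0F1 a t p) * pochhammer (2 * of_nat p + \<alpha>) T)"
  proof (rule has_sum_mono[OF has_sum_infsum[OF abs] has_sum_cmult_right[OF has_sum_infsum[OF sm]]])
    fix p
    have "norm (coeff_0F1 a t p) * norm (w p) \<le> norm (coeff_0F1 a t p) * (c * pochhammer (2 * of_nat p + \<alpha>) T)"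
      by (intro mult_left_mono assms) auto
    thus "norm (coeff_0F1 a t p * w p) \<le> c * (norm (coeff_0F1 a t p) * pochhammer (2 * of_nat p + \<alpha>) T)"
      by (simp add: norm_mult mult_ac)
  qed
  finally show ?thesis .
qed

lemma coeff_moment_bound:
  assumes "1 < q"
  shows "\<exists>D>0. \<forall>s. norm (coeff_moment a t s) \<le> D * q ^ s * fact s"
proof -
  obtain D where D: "D > 0"
    "\<And>T. (\<Sum>\<^sub>\<infinity>p. norm (coeff_0F1 a t p) * pochhammer (2 * of_nat p + 0) T) \<le> D * q ^ T * fact T"
    using coeff_growth[of 0 q] assms by blast
  have "norm (coeff_moment a t s) \<le> D * q ^ s * fact s" for s
    using norm_coeff_sum_le[OF order_refl _ coeff_moment_has_sum, of s 1 s] norm_pochhammer_of_nat_le D(2)[of s]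
    by simp
  thus ?thesis using D(1) by blast
qed

lemma fact_over_pochhammer_bound:
  assumes "1 < q"
  shows "\<exists>D>0. \<forall>s. fact s / norm (pochhammer a s) \<le> D * q ^ s"
  using pochhammer_ratio_bound[OF a_not_nonpos assms, of 1]
  by (simp add: norm_divide pochhammer_fact[symmetric])

text \<open>The sequence \<open>\<mu>\<close> of the introduction.\<close>

definition moment_ratio :: "nat \<Rightarrow> complex" where
  "moment_ratio s = coeff_moment a t s / pochhammer a s"

lemma moment_ratio_bound:
  assumes "1 < q"
  shows "\<exists>D>0. \<forall>s. norm (moment_ratio s) \<le> D * q ^ s"
proof -
  have q: "1 < sqrt q" using assms by simp
  obtain D1 where D1: "D1 > 0" "\<And>s. norm (coeff_moment a t s) \<le> D1 * sqrt q ^ s * fact s"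
    using coeff_moment_bound[OF q] by blast
  obtain D2 where D2: "D2 > 0" "\<And>s. fact s / norm (pochhammer a s) \<le> D2 * sqrt q ^ s"
    using fact_over_pochhammer_bound[OF q] by blast
  have "norm (moment_ratio s) \<le> (D1 * D2) * q ^ s" for s
  proof -
    have "norm (moment_ratio s) \<le> (D1 * sqrt q ^ s * fact s) / norm (pochhammer a s)"
      unfolding moment_ratio_def norm_divide by (intro divide_right_mono D1) auto
    also have "\<dots> = D1 * sqrt q ^ s * (fact s / norm (pochhammer a s))" by simp
    also have "\<dots> \<le> D1 * sqrt q ^ s * (D2 * sqrt q ^ s)"
      using D1 q by (intro mult_left_mono D2) auto
    also have "\<dots> = (D1 * D2) * (sqrt q * sqrt q) ^ s" by (simp only: power_mult_distrib mult_ac)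
    also have "sqrt q * sqrt q = q" using assms by simp
    finally show ?thesis .
  qed
  thus ?thesis using D1 D2 by (intro exI[of _ "D1 * D2"]) auto
qed

lemma coeff_transform_has_sum:
  "((\<lambda>p. coeff_0F1 a t p * (\<Sum>j\<le>T. of_nat (T choose j) * pochhammer (of_nat p) j
        * pochhammer (a - of_nat p) (T - j) / pochhammer a T * (1 - \<zeta>) ^ j))
     has_sum binomial_transform moment_ratio T \<zeta>) UNIV"
proof -
  have "((\<lambda>p. \<Sum>s\<le>T. of_nat (T choose s) * (- \<zeta>) ^ s * (coeff_0F1 a t p * pochhammer (of_nat p) s / pochhammer a s))
     has_sum binomial_transform moment_ratio T \<zeta>) UNIV"
    unfolding binomial_transform_def moment_ratio_def
    by (intro has_sum_finite_sum has_sum_cmult_right has_sum_divide_const coeff_moment_has_sum) auto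
  also have "(\<lambda>p. \<Sum>s\<le>T. of_nat (T choose s) * (- \<zeta>) ^ s * (coeff_0F1 a t p * pochhammer (of_nat p) s / pochhammer a s))
     = (\<lambda>p. coeff_0F1 a t p * (\<Sum>s\<le>T. of_nat (T choose s) * (- \<zeta>) ^ s * (pochhammer (of_nat p) s / pochhammer a s)))"
    by (simp add: sum_distrib_left mult_ac)
  finally show ?thesis
    unfolding binomial_reflection[OF pochhammer_a_nonzero(1)] .
qed

text \<open>After reflection the absolute values add up by Vandermonde's identity to \<open>(2 p + \<bar>a\<bar>)\<^sub>T / \<bar>(a)\<^sub>T\<bar>\<close>, which
  costs only subexponential growth in \<open>T\<close>; the disc contributes \<open>r\<^sup>T\<close>.\<close>

lemma coeff_transform_bound:
  assumes "1 \<le> r" "1 < q"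
  shows "\<exists>E. \<forall>T \<zeta>. norm (1 - \<zeta>) \<le> r \<longrightarrow> norm (binomial_transform moment_ratio T \<zeta>) \<le> E * (r * q) ^ T"
proof -
  have q: "1 < sqrt q" using assms by simp
  obtain D1 where D1: "D1 > 0"
    "\<And>T. (\<Sum>\<^sub>\<infinity>p. norm (coeff_0F1 a t p) * pochhammer (2 * of_nat p + norm a) T) \<le> D1 * sqrt q ^ T * fact T"
    using coeff_growth[of "norm a" "sqrt q"] q by auto
  obtain D2 where D2: "D2 > 0" "\<And>s. fact s / norm (pochhammer a s) \<le> D2 * sqrt q ^ s"
    using fact_over_pochhammer_bound[OF q] by blast
  have "norm (binomial_transform moment_ratio T \<zeta>) \<le> (D1 * D2) * (r * q) ^ T"
    if \<zeta>: "norm (1 - \<zeta>) \<le> r" for T \<zeta>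
  proof -
    define c where "c = r ^ T / norm (pochhammer a T)"
    have c: "0 \<le> c" using assms by (simp add: c_def)
    have "norm (binomial_transform moment_ratio T \<zeta>)
        \<le> c * (\<Sum>\<^sub>\<infinity>p. norm (coeff_0F1 a t p) * pochhammer (2 * of_nat p + norm a) T)"
    proof (rule norm_coeff_sum_le[OF norm_ge_zero _ coeff_transform_has_sum])
      fix p :: nat
      have "norm (\<Sum>j\<le>T. of_nat (T choose j) * pochhammer (of_nat p) j
              * pochhammer (a - of_nat p) (T - j) / pochhammer a T * (1 - \<zeta>) ^ j)
          \<le> (\<Sum>j\<le>T. c * (of_nat (T choose j) * pochhammer (of_nat p) j
              * pochhammer (of_nat p + norm a) (T - j)))"
      proof (rule sum_norm_le)
        fix j assume "j \<in> {..T}"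
        have 1: "norm (pochhammer (of_nat p :: complex) j) \<le> pochhammer (of_nat p) j"
          by (rule norm_pochhammer_le) simp
        have 2: "norm (pochhammer (a - of_nat p) (T - j)) \<le> pochhammer (of_nat p + norm a) (T - j)"
          by (rule norm_pochhammer_le) (use norm_triangle_ineq4[of a "of_nat p"] in simp)
        have "norm (1 - \<zeta>) ^ j \<le> r ^ j" using \<zeta> by (intro power_mono) auto
        also have "r ^ j \<le> r ^ T" using \<open>j \<in> _\<close> assms by (intro power_increasing) auto
        finally have 3: "norm (1 - \<zeta>) ^ j \<le> r ^ T" .
        have "norm (of_nat (T choose j) * pochhammer (of_nat p) j
              * pochhammer (a - of_nat p) (T - j) / pochhammer a T * (1 - \<zeta>) ^ j)
           \<le> of_nat (T choose j) * pochhammer (of_nat p) j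
              * pochhammer (of_nat p + norm a) (T - j) / norm (pochhammer a T) * r ^ T"
          unfolding norm_mult norm_divide norm_power norm_of_nat
          by (intro mult_mono divide_right_mono 1 2 3)
             (auto intro!: mult_nonneg_nonneg divide_nonneg_nonneg pochhammer_nonneg_real)
        thus "norm (of_nat (T choose j) * pochhammer (of_nat p) j
              * pochhammer (a - of_nat p) (T - j) / pochhammer a T * (1 - \<zeta>) ^ j)
           \<le> c * (of_nat (T choose j) * pochhammer (of_nat p) j
              * pochhammer (of_nat p + norm a) (T - j))"
          by (simp add: c_def mult_ac)
      qed
      also have "\<dots> = c * pochhammer (of_nat p + (of_nat p + norm a)) T"
        unfolding pochhammer_binomial_sum sum_distrib_left ..
      finally show "norm (\<Sum>j\<le>T. of_nat (T choose j) * pochhammer (of_nat p) j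
              * pochhammer (a - of_nat p) (T - j) / pochhammer a T * (1 - \<zeta>) ^ j)
          \<le> c * pochhammer (2 * of_nat p + norm a) T"
        by (simp add: add.assoc[symmetric])
    qed
    also have "\<dots> \<le> c * (D1 * sqrt q ^ T * fact T)" using c by (intro mult_left_mono D1)
    also have "\<dots> = D1 * sqrt q ^ T * r ^ T * (fact T / norm (pochhammer a T))" by (simp add: c_def)
    also have "\<dots> \<le> D1 * sqrt q ^ T * r ^ T * (D2 * sqrt q ^ T)"
      using D1 q assms by (intro mult_left_mono D2) auto
    also have "\<dots> = (D1 * D2) * (r * (sqrt q * sqrt q)) ^ T" by (simp only: power_mult_distrib mult_ac)
    also have "sqrt q * sqrt q = q" using assms by simp
    finally show ?thesis .
  qed
  thus ?thesis by blast
qed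

text \<open>At \<open>\<zeta> = 1\<close> only the term \<open>j = 0\<close> of the reflected sum survives.\<close>

lemma coeff_transform_at_1:
  "((\<lambda>p. coeff_0F1 a t p * (pochhammer (a - of_nat p) T / pochhammer a T))
     has_sum binomial_transform moment_ratio T 1) UNIV"
proof -
  have "(\<Sum>j\<le>T. of_nat (T choose j) * pochhammer (of_nat p) j
        * pochhammer (a - of_nat p) (T - j) / pochhammer a T * (1 - 1 :: complex) ^ j)
      = pochhammer (a - of_nat p) T / pochhammer a T" for p
    by (subst sum.mono_neutral_right[of _ "{0}"]) auto
  with coeff_transform_has_sum[of T 1] show ?thesis by simp
qed

text \<open>Absorbing \<open>A(s, q) = q / s\<close> turns \<open>binom s q\<close> into \<open>binom (s - 1) (q - 1)\<close>, and Vandermonde's convolution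
  gives \<open>s! binom (p + s - 1) s\<close>.  This is the reason for the choice of \<open>A(s, q)\<close>.\<close>

lemma sum_A_coeff_binomial:
  "(\<Sum>q\<le>s. A_coeff s q * fact s * of_nat (s choose q) * of_nat (p choose q)) = pochhammer (of_nat p) s"
proof (cases s)
  case (Suc s')
  have A: "A_coeff s q * of_nat (s choose q) = of_nat (s' choose (s - q))" if "q \<le> s" for q
  proof (cases q)
    case (Suc q')
    have "Suc q' * (Suc s' choose Suc q') = Suc s' * (s' choose q')"
      by (rule Suc_times_binomial)
    hence "of_nat (Suc q') * of_nat (Suc s' choose Suc q') = (of_nat (Suc s') * of_nat (s' choose q') :: complex)"
      by (metis of_nat_mult)
    hence "A_coeff s q * of_nat (s choose q) = of_nat (s' choose q')"
      unfolding A_coeff_def Suc \<open>s = Suc s'\<close> by (simp add: field_simps del: of_nat_Suc)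
    also have "s' choose q' = s' choose (s - q)"
      using that unfolding Suc \<open>s = Suc s'\<close> by (subst binomial_symmetric) auto
    finally show ?thesis .
  qed (simp add: A_coeff_def \<open>s = Suc s'\<close>)
  have *: "A_coeff s q * fact s * of_nat (s choose q) * of_nat (p choose q)
      = fact s * of_nat ((p choose q) * (s' choose (s - q)))" if "q \<le> s" for q
  proof -
    have "A_coeff s q * fact s * of_nat (s choose q) * of_nat (p choose q)
        = fact s * (of_nat (p choose q) * (A_coeff s q * of_nat (s choose q)))"
      by (simp only: mult_ac)
    thus ?thesis by (simp only: A[OF that] of_nat_mult)
  qed
  have "(\<Sum>q\<le>s. A_coeff s q * fact s * of_nat (s choose q) * of_nat (p choose q))
     = fact s * of_nat (\<Sum>q\<le>s. (p choose q) * (s' choose (s - q)))"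
    unfolding of_nat_sum sum_distrib_left
    by (intro sum.cong refl *) simp
  also have "\<dots> = fact s * of_nat ((p + s') choose s)"
    by (simp only: vandermonde)
  also have "\<dots> = pochhammer (of_nat p) s"
    unfolding binomial_gbinomial gbinomial_pochhammer' Suc
    by (simp del: fact_Suc)
  finally show ?thesis .
qed (simp add: A_coeff_def)

lemma hyp_0F1_shift_has_sum:
  "((\<lambda>p. coeff_0F1 a t p * of_nat (p choose q)) has_sum
     (- 1) ^ q / (pochhammer (1 - a) q * fact q) * t ^ q * hyp_0F1 (1 - a + of_nat q) (- t)) UNIV"
proof -
  define k where "k = (- 1) ^ q / (pochhammer (1 - a) q * fact q) * t ^ q"
  define u where "u n = (- t) ^ n / (pochhammer (1 - a + of_nat q) n * fact n)" for n
  have eq: "k * u n = coeff_0F1 a t (n + q) * of_nat ((n + q) choose q)" for n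
  proof -
    have "coeff_0F1 a t (n + q) * of_nat ((n + q) choose q)
       = (- t) ^ (q + n) / (pochhammer (1 - a) (q + n) * (fact q * fact n))"
      by (simp add: coeff_0F1_def binomial_fact add.commute)
    also have "\<dots> = k * u n"
      unfolding k_def u_def power_add pochhammer_product' power_minus[of t q] by (simp add: mult_ac)
    finally show ?thesis by simp
  qed
  have "(\<lambda>p. coeff_0F1 a t p * of_nat (p choose q)) abs_summable_on UNIV"
  proof (rule Infinite_Sum.abs_summable_on_comparison_test'[OF coeff_majorant[of 2]])
    fix p
    have "p choose q \<le> 2 ^ p"
      by (cases "q \<le> p") (auto simp: binomial_le_pow2)
    hence "real (p choose q) \<le> 2 ^ p"
      by (metis of_nat_le_iff of_nat_numeral of_nat_power)
    thus "norm (coeff_0F1 a t p * of_nat (p choose q)) \<le> norm (coeff_0F1 a t p) * 2 ^ p"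
      by (simp add: norm_mult mult_left_mono)
  qed auto
  hence "((\<lambda>p. coeff_0F1 a t p * of_nat (p choose q)) has_sum
      (\<Sum>\<^sub>\<infinity>p. coeff_0F1 a t p * of_nat (p choose q))) UNIV" (is "(_ has_sum ?S) _")
    by (rule has_sum_infsum[OF abs_summable_summable])
  hence S: "((\<lambda>p. coeff_0F1 a t p * of_nat (p choose q)) has_sum ?S) {q..}"
    by (subst has_sum_cong_neutral[of UNIV "{q..}"]) auto
  have "((\<lambda>n. k * u n) has_sum ?S) UNIV"
    unfolding eq
    using S by (subst has_sum_reindex_bij_witness[of UNIV "\<lambda>p. p - q" "\<lambda>n. n + q" "{q..}"
        "\<lambda>p. coeff_0F1 a t p * of_nat (p choose q)"]) auto
  hence sums: "(\<lambda>n. k * u n) sums ?S" by (rule has_sum_imp_sums)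
  have "?S = k * hyp_0F1 (1 - a + of_nat q) (- t)"
  \<comment> \<open>for \<open>t = 0 < q\<close> both sides vanish, but \<open>k = 0\<close> cannot be cancelled\<close>
  proof (cases "t = 0 \<and> q > 0")
    case True
    hence "k = 0" by (simp add: k_def)
    thus ?thesis using sums sums_unique by fastforce
  next
    case False
    hence "k \<noteq> 0" using pochhammer_a_nonzero(2) by (auto simp: k_def)
    hence "u sums (?S / k)" using sums_divide[OF sums, of k] by simp
    hence "hyp_0F1 (1 - a + of_nat q) (- t) = ?S / k"
      unfolding hyp_0F1_def u_def using sums_unique by force
    thus ?thesis using \<open>k \<noteq> 0\<close> by simp
  qed
  thus ?thesis
    using \<open>((\<lambda>p. coeff_0F1 a t p * of_nat (p choose q)) has_sum ?S) UNIV\<close> by (simp add: k_def)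
qed

lemma coeff_moment_eq_q_sum:
  "(\<Sum>q\<le>s. A_coeff s q * fact s * of_nat (s choose q) *
      ((- 1) ^ q / (pochhammer (1 - a) q * fact q) * t ^ q * hyp_0F1 (1 - a + of_nat q) (- t)))
   = coeff_moment a t s"
proof -
  have "((\<lambda>p. \<Sum>q\<le>s. A_coeff s q * fact s * of_nat (s choose q) * (coeff_0F1 a t p * of_nat (p choose q))) has_sum
     (\<Sum>q\<le>s. A_coeff s q * fact s * of_nat (s choose q) *
      ((- 1) ^ q / (pochhammer (1 - a) q * fact q) * t ^ q * hyp_0F1 (1 - a + of_nat q) (- t)))) UNIV"
    by (intro has_sum_finite_sum has_sum_cmult_right hyp_0F1_shift_has_sum) auto
  also have "(\<lambda>p. \<Sum>q\<le>s. A_coeff s q * fact s * of_nat (s choose q) * (coeff_0F1 a t p * of_nat (p choose q)))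
     = (\<lambda>p. coeff_0F1 a t p * pochhammer (of_nat p) s)"
    unfolding sum_A_coeff_binomial[symmetric] sum_distrib_left by (simp add: mult_ac)
  finally show ?thesis
    using coeff_moment_has_sum has_sum_unique by blast
qed

end

section \<open>The transformation of Pfaff\<close>

lemma gauss_F_sums:
  assumes C: "C \<notin> \<int>\<^sub>\<le>\<^sub>0" and x: "norm x < 1"
  shows "(\<lambda>n. pochhammer A n * pochhammer B n / (pochhammer C n * fact n) * x ^ n) sums gauss_F A B C x"
proof -
  obtain q where q: "1 < q" "q * norm x < 1"
  proof (cases "norm x = 0")
    case False
    hence "1 < 1 / norm x" using x by simp
    then obtain q where "1 < q" "q < 1 / norm x" using dense by blast
    thus ?thesis using False that[of q] by (simp add: field_simps)
  qed (use that[of 2] in auto)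
  obtain D where D: "D > 0" "\<And>n. norm (pochhammer A n / pochhammer C n) \<le> D * q ^ n"
    using pochhammer_ratio_bound[OF C q(1)] by blast
  have "(\<lambda>n. D * (pochhammer (norm B) n / fact n * (q * norm x) ^ n)) summable_on UNIV"
    by (intro summable_on_cmult_right has_sum_imp_summable[OF binomial_series_has_sum]) (use q in auto)
  hence "summable (\<lambda>n. D * (pochhammer (norm B) n / fact n * (q * norm x) ^ n))"
    by (rule summable_on_imp_summable)
  hence "summable (\<lambda>n. pochhammer A n * pochhammer B n / (pochhammer C n * fact n) * x ^ n)"
  proof (rule summable_comparison_test')
    fix n
    have "norm (pochhammer A n / pochhammer C n) * (norm (pochhammer B n) / fact n * norm x ^ n)
        \<le> (D * q ^ n) * (pochhammer (norm B) n / fact n * norm x ^ n)"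
      using D q by (intro mult_mono divide_right_mono D norm_pochhammer_le)
        (auto intro!: mult_nonneg_nonneg divide_nonneg_nonneg pochhammer_nonneg_real)
    thus "norm (pochhammer A n * pochhammer B n / (pochhammer C n * fact n) * x ^ n)
        \<le> D * (pochhammer (norm B) n / fact n * (q * norm x) ^ n)"
      by (simp add: norm_mult norm_divide norm_power power_mult_distrib mult_ac)
  qed
  thus ?thesis
    unfolding gauss_F_def by (rule summable_sums)
qed

lemma gauss_F_holomorphic:
  assumes "C \<notin> \<int>\<^sub>\<le>\<^sub>0"
  shows "gauss_F A B C holomorphic_on ball 0 1"
proof (rule power_series_holomorphic)
  fix w :: complex assume "w \<in> ball 0 1"
  thus "(\<lambda>n. pochhammer A n * pochhammer B n / (pochhammer C n * fact n) * (w - 0) ^ n) sums gauss_F A B C w"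
    using gauss_F_sums[OF assms] by simp
qed

lemma one_minus_powr_diff_nat:
  assumes "x \<noteq> (1::complex)"
  shows "(1 - x) powr (- (B + of_nat n)) = (1 - x) powr (- B) / (1 - x) ^ n"
proof -
  have "(1 - x) powr (- (B + of_nat n)) = (1 - x) powr (- B - of_nat n)" by simp
  also have "\<dots> = (1 - x) powr (- B) / (1 - x) powr (of_nat n)" by (rule powr_diff)
  also have "(1 - x) powr (of_nat n) = (1 - x) ^ n" using assms by (intro powr_nat') auto
  finally show ?thesis .
qed

text \<open>For small \<open>x\<close> the powers of \<open>1 - x\<close> may be expanded and the resulting double series regrouped by
  the exponent of \<open>x\<close>; the majorant \<open>(3 \<bar>x\<bar>)\<^sup>N\<close> converges for \<open>\<bar>x\<bar> < 1 / 3\<close>.\<close>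

lemma pfaff_near_0:
  assumes C: "C \<notin> \<int>\<^sub>\<le>\<^sub>0" and x: "norm x < 1 / 4"
  shows "gauss_F A B C x = (1 - x) powr (- B) * gauss_F (C - A) B C (x / (x - 1))"
proof -
  define G where "G = (\<lambda>(n, k). pochhammer (C - A) n * pochhammer B n / (pochhammer C n * fact n) * (- x) ^ n
      * (pochhammer (B + of_nat n) k / fact k * x ^ k))"
  have fib: "{p. (\<lambda>(n, k). n + k) p = N} = (\<lambda>n. (n, N - n)) ` {..N}" for N :: nat by force
  hence fin: "finite {p. (\<lambda>(n, k). n + k) p = N}" for N :: nat by simp
  have sum_fib: "(\<Sum>p\<in>{p. (\<lambda>(n, k). n + k) p = N}. g p) = (\<Sum>n\<le>N. g (n, N - n))"
    for g :: "nat \<times> nat \<Rightarrow> 'b::comm_monoid_add" and N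
    unfolding fib by (subst sum.reindex) (auto simp: inj_on_def)
  obtain D where D: "D > 0" "\<And>n. norm (pochhammer (C - A) n / pochhammer C n) \<le> D * 2 ^ n"
    using pochhammer_ratio_bound[OF C, of 2 "C - A"] by auto
  define M where "M = (\<lambda>(n, k). D * 2 ^ n * (pochhammer (norm B) (n + k) / (fact n * fact k) * norm x ^ (n + k)))"
  have "(M has_sum D * (1 - 3 * norm x) powr (- norm B)) UNIV"
  proof (rule has_sum_fibres_nonneg[OF _ fin])
    show "0 \<le> M p" for p
      using D by (cases p) (auto simp: M_def intro!: mult_nonneg_nonneg divide_nonneg_nonneg pochhammer_nonneg_real)
    have "(\<Sum>n\<le>N. M (n, N - n)) = D * (pochhammer (norm B) N / fact N * (3 * norm x) ^ N)" for N
    proof -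
      have "(\<Sum>n\<le>N. M (n, N - n))
          = (\<Sum>n\<le>N. D * pochhammer (norm B) N / fact N * norm x ^ N * (of_nat (N choose n) * 2 ^ n * 1 ^ (N - n)))"
        by (intro sum.cong) (auto simp: M_def binomial_fact)
      also have "\<dots> = D * pochhammer (norm B) N / fact N * norm x ^ N * (2 + 1) ^ N"
        unfolding binomial_ring sum_distrib_left ..
      finally show ?thesis by (simp add: power_mult_distrib)
    qed
    thus "((\<lambda>N. \<Sum>p\<in>{p. (\<lambda>(n, k). n + k) p = N}. M p) has_sum D * (1 - 3 * norm x) powr (- norm B)) UNIV"
      unfolding sum_fib using has_sum_cmult_right[OF binomial_series_has_sum[of "norm B" "3 * norm x"], of D] x
      by simp
  qed
  hence M: "M summable_on UNIV" by (rule has_sum_imp_summable)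
  have "norm (G p) \<le> M p" for p
  proof -
    obtain n k where p: "p = (n, k)" by (cases p)
    have "norm (G p) = norm (pochhammer (C - A) n / pochhammer C n) *
        (norm (pochhammer B (n + k)) / (fact n * fact k) * norm x ^ (n + k))"
      by (simp add: G_def p norm_mult norm_divide norm_power power_add pochhammer_product' mult_ac)
    also have "\<dots> \<le> (D * 2 ^ n) * (pochhammer (norm B) (n + k) / (fact n * fact k) * norm x ^ (n + k))"
      using D by (intro mult_mono divide_right_mono D norm_pochhammer_le)
        (auto intro!: mult_nonneg_nonneg divide_nonneg_nonneg pochhammer_nonneg_real)
    finally show ?thesis by (simp add: M_def p)
  qed
  hence abs: "(\<lambda>p. norm (G p)) summable_on UNIV"
    by (intro Infinite_Sum.abs_summable_on_comparison_test'[OF M]) auto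
  define S where "S = (\<Sum>\<^sub>\<infinity>p. G p)"
  have S: "(G has_sum S) UNIV"
    unfolding S_def by (rule has_sum_infsum[OF abs_summable_summable[OF abs]])
  have "(\<Sum>n\<le>N. G (n, N - n)) = pochhammer A N * pochhammer B N / (pochhammer C N * fact N) * x ^ N" for N
  proof -
    have "(\<Sum>n\<le>N. G (n, N - n)) = (\<Sum>n\<le>N. pochhammer B N / (pochhammer C N * fact N) * x ^ N
       * (of_nat (N choose n) * (- 1) ^ n * pochhammer (C - A) n * pochhammer (C + of_nat n) (N - n)))"
    proof (intro sum.cong refl, goal_cases)
      case (1 n)
      hence n: "n \<le> N" by simp
      have Cn: "pochhammer C N = pochhammer C n * pochhammer (C + of_nat n) (N - n)"
        using pochhammer_product[OF n] .
      have Bn: "pochhammer B N = pochhammer B n * pochhammer (B + of_nat n) (N - n)"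
        using pochhammer_product[OF n] .
      have xn: "x ^ N = x ^ n * x ^ (N - n)" using n by (simp flip: power_add)
      have nz: "pochhammer (C + of_nat n) (N - n) \<noteq> 0"
        using Cn pochhammer_nonzero[OF C, of N] by auto
      show ?case
        unfolding G_def prod.case power_minus[of x] Cn Bn xn using nz n
        by (simp add: binomial_fact mult_ac)
    qed
    also have "\<dots> = pochhammer B N / (pochhammer C N * fact N) * x ^ N * pochhammer (C - (C - A)) N"
      unfolding vandermonde_alternating[symmetric] sum_distrib_left ..
    finally show ?thesis by simp
  qed
  with has_sum_fibres[OF S fin]
  have "((\<lambda>N. pochhammer A N * pochhammer B N / (pochhammer C N * fact N) * x ^ N) has_sum S) UNIV"
    unfolding sum_fib by simp
  hence 1: "gauss_F A B C x = S"
    unfolding gauss_F_def by (metis has_sum_imp_sums sums_unique)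
  have x1: "x \<noteq> 1" using x by auto
  define c where "c = (1 - x) powr (- B)"
  have c: "c \<noteq> 0" using x1 by (simp add: c_def)
  have "((\<lambda>n. c * (pochhammer (C - A) n * pochhammer B n / (pochhammer C n * fact n) * (x / (x - 1)) ^ n))
      has_sum S) UNIV"
  proof (rule has_sum_SigmaD)
    show "(G has_sum S) (UNIV \<times> UNIV)" using S by simp
    fix n
    define h where "h = pochhammer (C - A) n * pochhammer B n / (pochhammer C n * fact n)"
    have "(\<lambda>k. G (n, k)) sums (h * (- x) ^ n * (1 - x) powr (- (B + of_nat n)))"
      using sums_mult[OF binomial_series_complex[of x "B + of_nat n"], of "h * (- x) ^ n"] x
      by (simp add: G_def h_def)
    moreover have "(\<lambda>k. G (n, k)) summable_on UNIV"
    proof -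
      have "(\<lambda>p. norm (G p)) summable_on UNIV \<times> UNIV" using abs by simp
      hence "(\<lambda>k. norm (G (n, k))) summable_on UNIV"
        unfolding Infinite_Sum.abs_summable_on_Sigma_iff by blast
      thus ?thesis by (rule abs_summable_summable)
    qed
    hence "(\<lambda>k. G (n, k)) sums (\<Sum>\<^sub>\<infinity>k. G (n, k))"
      by (intro has_sum_imp_sums has_sum_infsum)
    ultimately have "(\<Sum>\<^sub>\<infinity>k. G (n, k)) = h * (- x) ^ n * (1 - x) powr (- (B + of_nat n))"
      using sums_unique2 by blast
    also have "\<dots> = c * (h * (x / (x - 1)) ^ n)"
    proof -
      have "(- x) ^ n / (1 - x) ^ n = (x / (x - 1)) ^ n"
        unfolding power_divide[symmetric] by (metis minus_diff_eq minus_divide_divide minus_minus)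
      thus ?thesis
        unfolding one_minus_powr_diff_nat[OF x1] c_def by (metis (no_types, opaque_lifting) mult.assoc mult.commute times_divide_eq_right)
    qed
    finally show "((\<lambda>k. G (n, k)) has_sum
        c * (pochhammer (C - A) n * pochhammer B n / (pochhammer C n * fact n) * (x / (x - 1)) ^ n)) UNIV"
      using has_sum_infsum[OF \<open>(\<lambda>k. G (n, k)) summable_on UNIV\<close>] by (simp add: h_def)
  qed
  hence "(\<lambda>n. c * (pochhammer (C - A) n * pochhammer B n / (pochhammer C n * fact n) * (x / (x - 1)) ^ n)) sums S"
    by (rule has_sum_imp_sums)
  hence "(\<lambda>n. pochhammer (C - A) n * pochhammer B n / (pochhammer C n * fact n) * (x / (x - 1)) ^ n) sums (S / c)"
    using sums_divide[of _ S c] c by fastforce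
  hence "gauss_F (C - A) B C (x / (x - 1)) = S / c"
    unfolding gauss_F_def by (metis sums_unique)
  thus ?thesis using 1 c by (simp add: c_def)
qed

lemma norm_moebius_lt_1_iff:
  assumes "x \<noteq> (1::complex)"
  shows "norm (x / (x - 1)) < 1 \<longleftrightarrow> Re x < 1 / 2"
proof -
  have "norm (x / (x - 1)) < 1 \<longleftrightarrow> norm x < norm (x - 1)"
    using assms by (simp add: norm_divide divide_simps)
  also have "\<dots> \<longleftrightarrow> (norm x)\<^sup>2 < (norm (x - 1))\<^sup>2"
    by (meson abs_norm_cancel abs_square_less_1 norm_ge_zero power_strict_mono power2_less_imp_less zero_less_numeral)
  also have "\<dots> \<longleftrightarrow> Re x < 1 / 2"
    unfolding cmod_power2 by (simp add: power2_eq_square algebra_simps)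
  finally show ?thesis .
qed

text \<open>Both sides are holomorphic on the convex set where \<open>\<bar>x\<bar> < 1\<close> and \<open>Re x < 1 / 2\<close>; the second condition
  is \<open>\<bar>x / (x - 1)\<bar> < 1\<close>.\<close>

lemma pfaff_transformation:
  assumes C: "C \<notin> \<int>\<^sub>\<le>\<^sub>0" and x: "norm x < 1" "norm (x / (x - 1)) < 1"
  shows "gauss_F A B C x = (1 - x) powr (- B) * gauss_F (C - A) B C (x / (x - 1))"
proof -
  define S where "S = ball 0 1 \<inter> {w::complex. Re w < 1 / 2}"
  have ne1: "w \<noteq> 1" if "w \<in> S" for w using that by (auto simp: S_def)
  have "x \<noteq> 1" using x by auto
  hence xS: "x \<in> S" using x norm_moebius_lt_1_iff[of x] by (simp add: S_def)
  show ?thesis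
  proof (rule analytic_continuation_open[of "ball 0 (1 / 4)" S "gauss_F A B C"
        "\<lambda>w. (1 - w) powr (- B) * gauss_F (C - A) B C (w / (w - 1))", OF _ _ _ _ _ _ _ _ xS])
    show "open S" unfolding S_def by (intro open_Int open_ball open_halfspace_Re_lt)
    show "connected S"
      unfolding S_def by (intro convex_connected convex_Int convex_ball convex_halfspace_Re_lt)
    show "ball 0 (1 / 4) \<subseteq> S"
    proof
      fix w :: complex assume "w \<in> ball 0 (1 / 4)"
      thus "w \<in> S" using complex_Re_le_cmod[of w] by (simp add: S_def)
    qed
    show "gauss_F A B C holomorphic_on S"
      by (rule holomorphic_on_subset[OF gauss_F_holomorphic[OF C]]) (auto simp: S_def)
    show "(\<lambda>w. (1 - w) powr (- B) * gauss_F (C - A) B C (w / (w - 1))) holomorphic_on S"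
    proof (intro holomorphic_intros)
      show "1 - w \<notin> \<real>\<^sub>\<le>\<^sub>0" if "w \<in> S" for w
        using that by (auto simp: S_def complex_nonpos_Reals_iff)
      have "gauss_F (C - A) B C \<circ> (\<lambda>w. w / (w - 1)) holomorphic_on S"
      proof (rule holomorphic_on_compose_gen[OF _ gauss_F_holomorphic[OF C]])
        show "(\<lambda>w. w / (w - 1)) holomorphic_on S"
          by (intro holomorphic_intros) (use ne1 in auto)
        show "(\<lambda>w. w / (w - 1)) ` S \<subseteq> ball 0 1"
        proof
          fix u assume "u \<in> (\<lambda>w. w / (w - 1)) ` S"
          then obtain w where w: "w \<in> S" "u = w / (w - 1)" by blast
          thus "u \<in> ball 0 1" using norm_moebius_lt_1_iff[OF ne1[OF w(1)]] by (simp add: S_def)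
        qed
      qed
      thus "(\<lambda>w. gauss_F (C - A) B C (w / (w - 1))) holomorphic_on S" by (simp add: o_def)
    qed
    show "gauss_F A B C w = (1 - w) powr (- B) * gauss_F (C - A) B C (w / (w - 1))"
      if "w \<in> ball 0 (1 / 4)" for w
      using that by (intro pfaff_near_0[OF C]) simp
  qed auto
qed

definition hyp_coeff :: "complex \<Rightarrow> complex \<Rightarrow> complex \<Rightarrow> nat \<Rightarrow> complex" where
  "hyp_coeff b d x M = pochhammer b M / pochhammer d M * x ^ M"

text \<open>The power \<open>(1 - x)\<^sup>-\<^sup>b\<close> and the denominators in \<open>(x / (1 - x))\<^sup>I\<close> together are exactly the factor that Pfaff's
  transformation with parameter \<open>b + I\<close> removes.\<close>

lemma gauss_factor_eq_pochhammer_series: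
  assumes d: "d \<notin> \<int>\<^sub>\<le>\<^sub>0" and x: "norm x < 1" "norm (x / (x - 1)) < 1"
  shows "(1 - x) powr (- b) * (pochhammer b I / pochhammer d I * (x / (1 - x)) ^ I
       * gauss_F (d + of_nat I - A) (b + of_nat I) (d + of_nat I) (x / (x - 1)))
     = pochhammer_series A (\<lambda>u. hyp_coeff b d x (I + u))"
proof -
  have dI: "d + of_nat I \<notin> \<int>\<^sub>\<le>\<^sub>0"
  proof
    assume "d + of_nat I \<in> \<int>\<^sub>\<le>\<^sub>0"
    hence "d + of_nat I - of_nat I \<in> \<int>\<^sub>\<le>\<^sub>0" by (rule nonpos_Ints_diff_Nats) auto
    thus False using d by simp
  qed
  have x1: "x \<noteq> 1" using x by auto
  define k where "k = pochhammer b I / pochhammer d I * x ^ I"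
  have "(1 - x) powr (- b) * (pochhammer b I / pochhammer d I * (x / (1 - x)) ^ I
       * gauss_F (d + of_nat I - A) (b + of_nat I) (d + of_nat I) (x / (x - 1)))
     = k * ((1 - x) powr (- (b + of_nat I)) * gauss_F (d + of_nat I - A) (b + of_nat I) (d + of_nat I) (x / (x - 1)))"
    unfolding one_minus_powr_diff_nat[OF x1] k_def by (simp add: power_divide mult_ac)
  also have "\<dots> = k * gauss_F A (b + of_nat I) (d + of_nat I) x"
    by (subst pfaff_transformation[OF dI x]) simp
  also have "\<dots> = pochhammer_series A (\<lambda>u. hyp_coeff b d x (I + u))"
  proof -
    have "(\<lambda>u. k * (pochhammer A u * pochhammer (b + of_nat I) u / (pochhammer (d + of_nat I) u * fact u) * x ^ u))
        sums (k * gauss_F A (b + of_nat I) (d + of_nat I) x)"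
      by (intro sums_mult gauss_F_sums dI x)
    also have "(\<lambda>u. k * (pochhammer A u * pochhammer (b + of_nat I) u / (pochhammer (d + of_nat I) u * fact u) * x ^ u))
      = (\<lambda>u. pochhammer A u / fact u * hyp_coeff b d x (I + u))"
      by (simp add: k_def hyp_coeff_def pochhammer_product' power_add fun_eq_iff mult_ac)
    finally show ?thesis
      unfolding pochhammer_series_def by (simp add: sums_unique)
  qed
  finally show ?thesis .
qed

lemma hyp_coeff_bound:
  assumes "d \<notin> \<int>\<^sub>\<le>\<^sub>0" "1 < q"
  shows "\<exists>D>0. \<forall>M. norm (hyp_coeff b d x M) \<le> D * (q * norm x) ^ M"
proof -
  obtain D where D: "D > 0" "\<And>n. norm (pochhammer b n / pochhammer d n) \<le> D * q ^ n"
    using pochhammer_ratio_bound[OF assms] by blast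
  have "norm (hyp_coeff b d x M) \<le> D * (q * norm x) ^ M" for M
  proof -
    have "norm (hyp_coeff b d x M) \<le> (D * q ^ M) * norm x ^ M"
      unfolding hyp_coeff_def norm_mult norm_power by (intro mult_right_mono D) auto
    thus ?thesis by (simp add: power_mult_distrib mult_ac)
  qed
  thus ?thesis using D(1) by blast
qed

section \<open>The expansion as an iterated series\<close>

text \<open>Since \<open>a\<close> is not an integer, \<open>(a)\<^sub>T\<^sub>-\<^sub>p = (a)\<^sub>-\<^sub>p (a - p)\<^sub>T\<close>, and \<open>(a)\<^sub>-\<^sub>p\<close> is \<open>(- 1)\<^sup>p / (1 - a)\<^sub>p\<close>.\<close>

lemma pochhammer_int_eq_coeff_0F1:
  assumes a: "a \<notin> \<int>"
  shows "pochhammer_int a (int T - int p) * t ^ p / fact p = coeff_0F1 a t p * pochhammer (a - of_nat p) T"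
proof -
  define g where "g = Gamma (a - of_nat p)"
  have nonint: "a - of_nat p \<notin> \<int>\<^sub>\<le>\<^sub>0"
    using a nonpos_Ints_Int[of "a - of_nat p"] Ints_add[of "a - of_nat p" "of_nat p"] by auto
  have g: "g \<noteq> 0" using nonint by (simp add: g_def Gamma_eq_zero_iff)
  have "pochhammer (1 - a) p = (- 1) ^ p * pochhammer (a - of_nat p) p"
    using pochhammer_minus[of "a - 1" p] by simp
  hence p: "pochhammer (1 - a) p = (- 1) ^ p * (Gamma a / g)"
    using pochhammer_Gamma[OF nonint, of p] by (simp add: g_def)
  have T: "pochhammer (a - of_nat p) T = Gamma (a + of_nat T - of_nat p) / g"
    using pochhammer_Gamma[OF nonint, of T] by (simp add: g_def algebra_simps)
  have m1: "(- 1 :: complex) ^ p * (- 1) ^ p = 1" by (simp flip: power_mult_distrib)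
  show ?thesis
    unfolding pochhammer_int_def coeff_0F1_def p T power_minus[of t] using g m1
    by (simp add: algebra_simps divide_simps)
qed

text \<open>Leaves room for the fourfold loss of a factor \<open>q\<close> in \<open>expansion_infsum\<close>: one in the bound of \<open>f T\<close>,
  one for the radius of the disc, one in the bound of the transform, and one to spare.\<close>

lemma exists_power4_lt:
  fixes r c :: real
  assumes "0 \<le> r" "r < c"
  shows "\<exists>q>1. q ^ 4 * r < c"
proof -
  obtain m where m: "1 < m" "m * r < c"
  proof (cases "r = 0")
    case False
    hence "1 < c / r" using assms by simp
    then obtain m where "1 < m" "m < c / r" using dense by blast
    thus ?thesis using False assms that[of m] by (simp add: field_simps)
  qed (use that[of 2] assms in auto)
  have "root 4 m ^ 4 = m" using m by (intro real_root_pow_pos2) auto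
  moreover have "1 < root 4 m" using m by simp
  ultimately show ?thesis using m by (intro exI[of _ "root 4 m"]) auto
qed

definition shifted_outer ::
  "complex \<Rightarrow> (nat \<Rightarrow> complex) \<Rightarrow> (nat \<Rightarrow> complex) \<Rightarrow> (nat \<Rightarrow> complex)
    \<Rightarrow> nat \<Rightarrow> nat \<times> nat \<times> nat \<Rightarrow> complex" where
  "shifted_outer a B1 B2 B3 s p = (\<Sum>(i, j, k)\<in>triples s.
     bc_outer (a + of_nat s) (\<lambda>M. B1 (i + M)) (\<lambda>M. B2 (j + M)) (\<lambda>M. B3 (k + M)) p
       / (fact i * fact j * fact k))"

definition shifted_total ::
  "complex \<Rightarrow> (nat \<Rightarrow> complex) \<Rightarrow> (nat \<Rightarrow> complex) \<Rightarrow> (nat \<Rightarrow> complex) \<Rightarrow> nat \<Rightarrow> complex" where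
  "shifted_total a B1 B2 B3 s = (\<Sum>(i, j, k)\<in>triples s.
     (\<Sum>\<^sub>\<infinity>p. lauricella_term (a + of_nat s) (\<lambda>M. B1 (i + M)) (\<lambda>M. B2 (j + M)) (\<lambda>M. B3 (k + M)) p)
       / (fact i * fact j * fact k))"

definition expansion_summand ::
  "complex \<Rightarrow> complex \<Rightarrow> (nat \<Rightarrow> complex) \<Rightarrow> (nat \<Rightarrow> complex) \<Rightarrow> (nat \<Rightarrow> complex)
    \<Rightarrow> nat \<times> (nat \<times> nat \<times> nat) \<Rightarrow> complex" where
  "expansion_summand a t B1 B2 B3 = (\<lambda>(s, p). (- 1) ^ s * coeff_moment a t s * shifted_outer a B1 B2 B3 s p)"

definition H_summand ::
  "complex \<Rightarrow> complex \<Rightarrow> (nat \<Rightarrow> complex) \<Rightarrow> (nat \<Rightarrow> complex) \<Rightarrow> (nat \<Rightarrow> complex)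
    \<Rightarrow> nat \<times> (nat \<times> nat \<times> nat) \<Rightarrow> complex" where
  "H_summand a t B1 B2 B3 = (\<lambda>(p, P). coeff_0F1 a t p * lauricella_term (a - of_nat p) B1 B2 B3 P)"

context
  fixes a t :: complex and B1 B2 B3 :: "nat \<Rightarrow> complex" and C1 C2 C3 x y z :: real
  assumes a: "a \<notin> \<int>" and C: "0 \<le> C1" "0 \<le> C2" "0 \<le> C3"
    and nonneg: "0 \<le> x" "0 \<le> y" "0 \<le> z" and lt: "x + y + z < 1"
    and B: "\<And>M. norm (B1 M) \<le> C1 * x ^ M" "\<And>M. norm (B2 M) \<le> C2 * y ^ M"
       "\<And>M. norm (B3 M) \<le> C3 * z ^ M"
begin

lemma B_shift:
  "norm (B1 (i + M)) \<le> (C1 * x ^ i) * x ^ M"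
  "norm (B2 (i + M)) \<le> (C2 * y ^ i) * y ^ M"
  "norm (B3 (i + M)) \<le> (C3 * z ^ i) * z ^ M"
  using B[of "i + M"] by (simp_all add: power_add mult.assoc)

lemma C_shift: "0 \<le> C1 * x ^ i" "0 \<le> C2 * y ^ j" "0 \<le> C3 * z ^ k"
  using C nonneg by auto

lemma norm_shift: "norm (a + of_nat s) \<le> norm a + of_nat s"
  using norm_triangle_ineq[of a "of_nat s"] by simp

lemmas bc_outer_shift_has_sum = bc_outer_has_sum[where A = "a + of_nat s" and \<beta> = "norm a + of_nat s" and x = x and y = y and z = z
      and ?B1.0 = "\<lambda>M. B1 (i + M)" and ?B2.0 = "\<lambda>M. B2 (j + M)" and ?B3.0 = "\<lambda>M. B3 (k + M)"
      and ?C1.0 = "C1 * x ^ i" and ?C2.0 = "C2 * y ^ j" and ?C3.0 = "C3 * z ^ k"] for s i j k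
lemmas bc_outer_shift_abs_summable = bc_outer_abs_summable[where A = "a + of_nat s" and \<beta> = "norm a + of_nat s" and x = x and y = y and z = z
      and ?B1.0 = "\<lambda>M. B1 (i + M)" and ?B2.0 = "\<lambda>M. B2 (j + M)" and ?B3.0 = "\<lambda>M. B3 (k + M)"
      and ?C1.0 = "C1 * x ^ i" and ?C2.0 = "C2 * y ^ j" and ?C3.0 = "C3 * z ^ k"] for s i j k
lemmas bc_outer_shift_abs_le = bc_outer_abs_le[where A = "a + of_nat s" and \<beta> = "norm a + of_nat s" and x = x and y = y and z = z
      and ?B1.0 = "\<lambda>M. B1 (i + M)" and ?B2.0 = "\<lambda>M. B2 (j + M)" and ?B3.0 = "\<lambda>M. B3 (k + M)"
      and ?C1.0 = "C1 * x ^ i" and ?C2.0 = "C2 * y ^ j" and ?C3.0 = "C3 * z ^ k"] for s i j k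

lemma shifted_outer_has_sum: "(shifted_outer a B1 B2 B3 s has_sum shifted_total a B1 B2 B3 s) UNIV"
  unfolding shifted_outer_def shifted_total_def
proof (rule has_sum_finite_sum[OF finite_triples])
  fix q :: "nat \<times> nat \<times> nat"
  obtain i j k where q: "q = (i, j, k)" by (cases q)
  show "((\<lambda>p. case q of (i, j, k) \<Rightarrow>
      bc_outer (a + of_nat s) (\<lambda>M. B1 (i + M)) (\<lambda>M. B2 (j + M)) (\<lambda>M. B3 (k + M)) p
       / (fact i * fact j * fact k)) has_sum (case q of (i, j, k) \<Rightarrow>
     (\<Sum>\<^sub>\<infinity>p. lauricella_term (a + of_nat s) (\<lambda>M. B1 (i + M)) (\<lambda>M. B2 (j + M)) (\<lambda>M. B3 (k + M)) p)
       / (fact i * fact j * fact k))) UNIV"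
    unfolding q prod.case
    by (rule has_sum_divide_const, rule bc_outer_shift_has_sum)
       (rule norm_shift nonneg lt C_shift B_shift)+
qed

lemma shifted_outer_abs_summable: "(\<lambda>p. norm (shifted_outer a B1 B2 B3 s p)) summable_on UNIV"
  and shifted_outer_abs_le: "(\<Sum>\<^sub>\<infinity>p. norm (shifted_outer a B1 B2 B3 s p))
      \<le> C1 * C2 * C3 * (x + y + z) ^ s / fact s * (1 - (x + y + z)) powr (- (norm a + of_nat s))"
proof -
  define g where "g = (\<lambda>(i, j, k) p. norm (bc_outer (a + of_nat s) (\<lambda>M. B1 (i + M)) (\<lambda>M. B2 (j + M)) (\<lambda>M. B3 (k + M)) p)
       / (fact i * fact j * fact k))"
  define R where "R = (1 - (x + y + z)) powr (- (norm a + of_nat s))"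
  define S where "S = (\<lambda>(i, j, k). (\<Sum>\<^sub>\<infinity>p. norm (bc_outer (a + of_nat s) (\<lambda>M. B1 (i + M)) (\<lambda>M. B2 (j + M)) (\<lambda>M. B3 (k + M)) p))
       / (fact i * fact j * fact k :: real))"
  have g: "(g q has_sum S q) UNIV" for q
  proof -
    obtain i j k where q: "q = (i, j, k)" by (cases q)
    show ?thesis
      unfolding q g_def S_def prod.case
      by (rule has_sum_divide_const, rule has_sum_infsum, rule bc_outer_shift_abs_summable)
         (rule norm_shift nonneg lt C_shift B_shift)+
  qed
  have sum_g: "((\<lambda>p. \<Sum>q\<in>triples s. g q p) has_sum (\<Sum>q\<in>triples s. S q)) UNIV"
    by (rule has_sum_finite_sum[OF finite_triples g])
  have le: "norm (shifted_outer a B1 B2 B3 s p) \<le> (\<Sum>q\<in>triples s. g q p)" for p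
    unfolding shifted_outer_def
    by (rule sum_norm_le) (auto simp: g_def norm_divide norm_mult)
  show sm: "(\<lambda>p. norm (shifted_outer a B1 B2 B3 s p)) summable_on UNIV"
    by (rule Infinite_Sum.abs_summable_on_comparison_test'[OF has_sum_imp_summable[OF sum_g] le])
  have "(\<Sum>\<^sub>\<infinity>p. norm (shifted_outer a B1 B2 B3 s p)) \<le> (\<Sum>q\<in>triples s. S q)"
    by (rule has_sum_mono[OF has_sum_infsum[OF sm] sum_g le])
  also have "\<dots> \<le> (\<Sum>(i, j, k)\<in>triples s. C1 * C2 * C3 * R * (x ^ i * y ^ j * z ^ k / (fact i * fact j * fact k)))"
  proof (rule sum_mono)
    fix q :: "nat \<times> nat \<times> nat"
    obtain i j k where q: "q = (i, j, k)" by (cases q)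
    have "S q \<le> ((C1 * x ^ i) * (C2 * y ^ j) * (C3 * z ^ k)) * R / (fact i * fact j * fact k)"
      unfolding q S_def R_def prod.case
      by (rule divide_right_mono, rule bc_outer_shift_abs_le)
         (rule norm_shift nonneg lt C_shift B_shift | simp)+
    thus "S q \<le> (case q of (i, j, k) \<Rightarrow> C1 * C2 * C3 * R * (x ^ i * y ^ j * z ^ k / (fact i * fact j * fact k)))"
      by (simp add: q mult_ac)
  qed
  also have "\<dots> = C1 * C2 * C3 * R * ((x + y + z) ^ s / fact s)"
    unfolding multinomial_triples[symmetric] sum_distrib_left by (intro sum.cong) auto
  finally show "(\<Sum>\<^sub>\<infinity>p. norm (shifted_outer a B1 B2 B3 s p))
      \<le> C1 * C2 * C3 * (x + y + z) ^ s / fact s * (1 - (x + y + z)) powr (- (norm a + of_nat s))"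
    by (simp add: R_def mult_ac)
qed

text \<open>The ratio of the geometric majorant is \<open>\<rho> / (1 - \<rho>)\<close> with \<open>\<rho> = x + y + z\<close>, which is less than \<open>1\<close> exactly when
  \<open>\<rho> < 1 / 2\<close>; the room left absorbs the subexponential growth of \<open>coeff_moment a t s / s!\<close>.\<close>

lemma expansion_summable:
  assumes half: "x + y + z < 1 / 2"
  shows "expansion_summand a t B1 B2 B3 summable_on UNIV"
proof -
  define \<rho> where "\<rho> = x + y + z"
  have \<rho>: "0 \<le> \<rho>" "\<rho> < 1 / 2" using nonneg half by (auto simp: \<rho>_def)
  define \<kappa> where "\<kappa> = \<rho> / (1 - \<rho>)"
  have \<kappa>: "0 \<le> \<kappa>" "\<kappa> < 1" using \<rho> by (auto simp: \<kappa>_def field_simps)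
  obtain w where w: "1 < w" "w ^ 4 * \<kappa> < 1" using exists_power4_lt[OF \<kappa>] by blast
  have w': "w * \<kappa> < 1"
  proof -
    have "w ^ 1 * \<kappa> \<le> w ^ 4 * \<kappa>" using w \<kappa> by (intro mult_right_mono power_increasing) auto
    thus ?thesis using w by simp
  qed
  obtain D where D: "D > 0" "\<And>s. norm (coeff_moment a t s) \<le> D * w ^ s * fact s"
    using coeff_moment_bound[OF a w(1)] by blast
  define K where "K = D * (C1 * C2 * C3) * (1 - \<rho>) powr (- norm a)"
  have slice: "(\<lambda>p. norm (expansion_summand a t B1 B2 B3 (s, p))) summable_on UNIV" for s
    unfolding expansion_summand_def prod.case norm_mult
    by (intro summable_on_cmult_right shifted_outer_abs_summable)
  have bound: "(\<Sum>\<^sub>\<infinity>p. norm (expansion_summand a t B1 B2 B3 (s, p))) \<le> K * (w * \<kappa>) ^ s" for s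
  proof -
    have "(\<Sum>\<^sub>\<infinity>p. norm (expansion_summand a t B1 B2 B3 (s, p)))
        = norm (coeff_moment a t s) * (\<Sum>\<^sub>\<infinity>p. norm (shifted_outer a B1 B2 B3 s p))"
      by (simp add: expansion_summand_def norm_mult norm_power infsum_cmult_right')
    also have "\<dots> \<le> (D * w ^ s * fact s) *
        (C1 * C2 * C3 * \<rho> ^ s / fact s * (1 - \<rho>) powr (- (norm a + of_nat s)))"
      using D w C unfolding \<rho>_def
      by (intro mult_mono D shifted_outer_abs_le) (auto intro!: infsum_nonneg)
    also have "(1 - \<rho>) powr (- (norm a + of_nat s)) = (1 - \<rho>) powr (- norm a) / (1 - \<rho>) ^ s"
    proof -
      have "(1 - \<rho>) powr (- (norm a + of_nat s)) = (1 - \<rho>) powr (- norm a - of_nat s)" by simp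
      also have "\<dots> = (1 - \<rho>) powr (- norm a) / (1 - \<rho>) powr (of_nat s)" by (rule powr_diff)
      also have "(1 - \<rho>) powr (of_nat s) = (1 - \<rho>) ^ s" using \<rho> by (intro powr_realpow) auto
      finally show ?thesis .
    qed
    also have "(D * w ^ s * fact s) * (C1 * C2 * C3 * \<rho> ^ s / fact s * ((1 - \<rho>) powr (- norm a) / (1 - \<rho>) ^ s))
        = K * (w * \<kappa>) ^ s"
      by (simp add: K_def \<kappa>_def power_mult_distrib power_divide)
    finally show ?thesis .
  qed
  have geom: "(\<lambda>s. K * (w * \<kappa>) ^ s) summable_on UNIV"
  proof (rule summable_nonneg_imp_summable_on)
    show "summable (\<lambda>s. K * (w * \<kappa>) ^ s)"
      using w w' \<kappa> by (intro summable_mult summable_geometric) auto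
  qed (use D C w \<kappa> in \<open>auto simp: K_def\<close>)
  have "(\<lambda>p. norm (expansion_summand a t B1 B2 B3 p)) summable_on UNIV \<times> UNIV"
  proof (rule summable_on_SigmaI)
    show "((\<lambda>p. norm (expansion_summand a t B1 B2 B3 (s, p))) has_sum
        (\<Sum>\<^sub>\<infinity>p. norm (expansion_summand a t B1 B2 B3 (s, p)))) UNIV" for s
      using slice by (rule has_sum_infsum)
    show "(\<lambda>s. \<Sum>\<^sub>\<infinity>p. norm (expansion_summand a t B1 B2 B3 (s, p))) summable_on UNIV"
      by (rule summable_on_comparison_test[OF geom bound]) (auto intro!: infsum_nonneg)
  qed simp
  thus ?thesis
    using abs_summable_summable[of "expansion_summand a t B1 B2 B3" "UNIV \<times> UNIV"] by simp
qed

lemma norm_lauricella_coefficient_le: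
  assumes "1 < q"
  shows "\<exists>K. \<forall>T. norm (pochhammer a T * hom_coeff B1 B2 B3 T) \<le> K * (q * (x + y + z)) ^ T"
proof -
  obtain D where D: "D > 0" "\<And>n. norm (pochhammer a n / pochhammer 1 n) \<le> D * q ^ n"
    using pochhammer_ratio_bound[of 1 q a] assms by auto
  have "norm (pochhammer a T * hom_coeff B1 B2 B3 T) \<le> (D * (C1 * C2 * C3)) * (q * (x + y + z)) ^ T" for T
  proof -
    have "norm (pochhammer a T * hom_coeff B1 B2 B3 T)
        \<le> (D * q ^ T * fact T) * ((C1 * C2 * C3) * (x + y + z) ^ T / fact T)"
      unfolding norm_mult
    proof (rule mult_mono)
      show "norm (pochhammer a T) \<le> D * q ^ T * fact T"
        using D(2)[of T] by (simp add: norm_divide pochhammer_fact[symmetric] field_simps)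
      show "norm (hom_coeff B1 B2 B3 T) \<le> (C1 * C2 * C3) * (x + y + z) ^ T / fact T"
        by (rule norm_hom_coeff_le[OF nonneg C B])
    qed (use D assms in auto)
    thus ?thesis by (simp add: power_mult_distrib mult_ac)
  qed
  thus ?thesis by blast
qed

lemma expansion_infsum:
  assumes sm: "expansion_summand a t B1 B2 B3 summable_on UNIV"
  shows "(\<Sum>\<^sub>\<infinity>p. expansion_summand a t B1 B2 B3 p)
      = (\<Sum>T. pochhammer a T * hom_coeff B1 B2 B3 T * binomial_transform (moment_ratio a t) T 1)"
proof -
  define \<rho> where "\<rho> = x + y + z"
  have \<rho>: "0 \<le> \<rho>" "\<rho> < 1" using nonneg lt by (auto simp: \<rho>_def)
  obtain q where q: "1 < q" "q ^ 4 * \<rho> < 1" using exists_power4_lt[OF \<rho>] by blast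
  have q1: "q * \<rho> < 1"
  proof -
    have "q ^ 1 * \<rho> \<le> q ^ 4 * \<rho>" using q \<rho> by (intro mult_right_mono power_increasing) auto
    thus ?thesis using q by simp
  qed
  have q2: "(q * q) * (q * \<rho>) < 1"
  proof -
    have "q ^ 3 * \<rho> \<le> q ^ 4 * \<rho>" using q \<rho> by (intro mult_right_mono power_increasing) auto
    thus ?thesis using q by (simp add: power3_eq_cube mult_ac)
  qed
  define g where "g s = pochhammer a s * shifted_total a B1 B2 B3 s" for s
  have summand: "(- 1) ^ s * coeff_moment a t s * shifted_total a B1 B2 B3 s = (- 1) ^ s * moment_ratio a t s * g s" for s
    using pochhammer_a_nonzero(1)[OF a] by (simp add: moment_ratio_def[OF a] g_def)
  have slice: "((\<lambda>p. expansion_summand a t B1 B2 B3 (s, p)) has_sum (- 1) ^ s * moment_ratio a t s * g s) UNIV" for s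
    unfolding expansion_summand_def prod.case summand[symmetric]
    by (intro has_sum_cmult_right shifted_outer_has_sum)
  have "((\<lambda>s. (- 1) ^ s * moment_ratio a t s * g s) has_sum (\<Sum>\<^sub>\<infinity>p. expansion_summand a t B1 B2 B3 p)) UNIV"
  proof (rule has_sum_SigmaD)
    show "(expansion_summand a t B1 B2 B3 has_sum (\<Sum>\<^sub>\<infinity>p. expansion_summand a t B1 B2 B3 p)) (UNIV \<times> UNIV)"
      using has_sum_infsum[OF sm] by simp
    show "((\<lambda>p. expansion_summand a t B1 B2 B3 (s, p)) has_sum (- 1) ^ s * moment_ratio a t s * g s) UNIV" for s
      by (rule slice)
  qed
  note series = this
  have "(\<lambda>s. (- 1) ^ s * moment_ratio a t s * g s) abs_summable_on UNIV"
    using has_sum_imp_summable[OF series] by (rule summable_on_iff_abs_summable_on_complex[THEN iffD1])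
  hence abs: "(\<lambda>s. norm (moment_ratio a t s * g s)) summable_on UNIV"
    by (simp add: norm_mult norm_power)
  obtain K where K: "\<And>T. norm (pochhammer a T * hom_coeff B1 B2 B3 T) \<le> K * (q * \<rho>) ^ T"
    using norm_lauricella_coefficient_le[OF q(1)] unfolding \<rho>_def by blast
  obtain E where E: "\<And>T \<zeta>. norm (1 - \<zeta>) \<le> q \<Longrightarrow>
      norm (binomial_transform (moment_ratio a t) T \<zeta>) \<le> E * (q * q) ^ T"
    using coeff_transform_bound[OF a less_imp_le[OF q(1)] q(1)] by blast
  obtain D where D: "\<And>s. norm (moment_ratio a t s) \<le> D * 2 ^ s"
    using moment_ratio_bound[OF a, of 2] by auto
  have "(\<Sum>\<^sub>\<infinity>s. (- 1) ^ s * moment_ratio a t s * g s)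
      = (\<Sum>T. pochhammer a T * hom_coeff B1 B2 B3 T * binomial_transform (moment_ratio a t) T 1)"
  proof (rule binomial_resummation[OF K _ q1 _ D E q(1) _ q2 abs])
    show "((\<lambda>T. of_nat (T choose s) * (pochhammer a T * hom_coeff B1 B2 B3 T)) has_sum g s) UNIV" for s
      unfolding g_def shifted_total_def by (rule shifted_lauricella_sum[OF nonneg lt C B])
  qed (use q \<rho> in auto)
  thus ?thesis using infsumI[OF series] by simp
qed

text \<open>Both the fourfold series and its rearrangement by total degree converge absolutely: for fixed
  \<open>p\<close> the sum is at most a constant times \<open>(1 - \<rho>)\<close> to the power \<open>- (2 p + \<bar>a\<bar>)\<close>, which the coefficients \<open>coeff_0F1\<close>
  dominate.\<close>

lemma H_infsum:
  "(\<Sum>\<^sub>\<infinity>p. H_summand a t B1 B2 B3 p)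
      = (\<Sum>T. pochhammer a T * hom_coeff B1 B2 B3 T * binomial_transform (moment_ratio a t) T 1)"
proof -
  define \<rho> where "\<rho> = x + y + z"
  have \<rho>: "0 \<le> \<rho>" "\<rho> < 1" using nonneg lt by (auto simp: \<rho>_def)
  define \<beta> where "\<beta> p = 2 * of_nat p + norm a" for p :: nat
  have \<beta>: "norm (a - of_nat p) \<le> \<beta> p" "0 \<le> \<beta> p" for p
    using norm_triangle_ineq4[of a "of_nat p"] by (auto simp: \<beta>_def)
  note L = \<beta>(1) nonneg lt C B
  define c where "c = C1 * C2 * C3"
  have c: "0 \<le> c" using C by (simp add: c_def)
  have maj: "(\<lambda>p. norm (coeff_0F1 a t p) * (c * (1 - \<rho>) powr (- \<beta> p))) summable_on UNIV"
  \<comment> \<open>\<open>coeff_powr_summable\<close> needs a base strictly below \<open>1\<close>\<close>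
  proof (cases "\<rho> = 0")
    case True
    have "(\<lambda>p. norm (coeff_0F1 a t p) * 1 ^ p) summable_on UNIV" by (rule coeff_majorant[OF a]) simp
    thus ?thesis using True by (simp add: summable_on_cmult_left)
  next
    case False
    hence "(\<lambda>p. norm (coeff_0F1 a t p) * (1 - \<rho>) powr (- (2 * of_nat p + norm a))) summable_on UNIV"
      using \<rho> by (intro coeff_powr_summable[OF a]) auto
    from summable_on_cmult_left[OF this, of c] show ?thesis by (simp add: \<beta>_def mult_ac)
  qed
  have sliceH: "((\<lambda>P. H_summand a t B1 B2 B3 (p, P)) has_sum coeff_0F1 a t p * (\<Sum>\<^sub>\<infinity>P. lauricella_term (a - of_nat p) B1 B2 B3 P)) UNIV" for p
    unfolding H_summand_def prod.case
    by (rule has_sum_cmult_right, rule has_sum_infsum, rule abs_summable_summable,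
        rule lauricella_abs_summable[OF L])
  have sliceH_abs: "(\<lambda>P. norm (H_summand a t B1 B2 B3 (p, P))) summable_on UNIV" for p
    unfolding H_summand_def prod.case norm_mult
    by (rule summable_on_cmult_right, rule lauricella_abs_summable[OF L])
  have le: "(\<Sum>\<^sub>\<infinity>P. norm (H_summand a t B1 B2 B3 (p, P))) \<le> norm (coeff_0F1 a t p) * (c * (1 - \<rho>) powr (- \<beta> p))" for p
  proof -
    have "(\<Sum>\<^sub>\<infinity>P. norm (H_summand a t B1 B2 B3 (p, P)))
        = norm (coeff_0F1 a t p) * (\<Sum>\<^sub>\<infinity>P. norm (lauricella_term (a - of_nat p) B1 B2 B3 P))"
      by (simp add: H_summand_def norm_mult infsum_cmult_right')
    also have "\<dots> \<le> norm (coeff_0F1 a t p) * (c * (1 - \<rho>) powr (- \<beta> p))"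
      unfolding c_def \<rho>_def by (intro mult_left_mono lauricella_abs_le[OF L]) auto
    finally show ?thesis .
  qed
  have "(\<lambda>p. norm (H_summand a t B1 B2 B3 p)) summable_on UNIV \<times> UNIV"
  proof (rule summable_on_SigmaI)
    show "((\<lambda>P. norm (H_summand a t B1 B2 B3 (p, P))) has_sum
        (\<Sum>\<^sub>\<infinity>P. norm (H_summand a t B1 B2 B3 (p, P)))) UNIV" for p
      using sliceH_abs by (rule has_sum_infsum)
    show "(\<lambda>p. \<Sum>\<^sub>\<infinity>P. norm (H_summand a t B1 B2 B3 (p, P))) summable_on UNIV"
      by (rule summable_on_comparison_test[OF maj le]) (auto intro!: infsum_nonneg)
  qed simp
  hence HS: "(H_summand a t B1 B2 B3 has_sum (\<Sum>\<^sub>\<infinity>p. H_summand a t B1 B2 B3 p)) (UNIV \<times> UNIV)"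
    using has_sum_infsum[OF abs_summable_summable[of "H_summand a t B1 B2 B3" "UNIV \<times> UNIV"]] by simp
  have H: "((\<lambda>p. coeff_0F1 a t p * (\<Sum>\<^sub>\<infinity>P. lauricella_term (a - of_nat p) B1 B2 B3 P)) has_sum
      (\<Sum>\<^sub>\<infinity>p. H_summand a t B1 B2 B3 p)) UNIV"
  proof (rule has_sum_SigmaD[OF HS])
    show "((\<lambda>P. H_summand a t B1 B2 B3 (p, P)) has_sum
        coeff_0F1 a t p * (\<Sum>\<^sub>\<infinity>P. lauricella_term (a - of_nat p) B1 B2 B3 P)) UNIV" for p
      by (rule sliceH)
  qed
  define Y where "Y = (\<lambda>(p, T). coeff_0F1 a t p * (pochhammer (a - of_nat p) T * hom_coeff B1 B2 B3 T))"
  have "(\<lambda>(p, T). norm (coeff_0F1 a t p) * (c * (pochhammer (\<beta> p) T / fact T * \<rho> ^ T))) summable_on UNIV \<times> UNIV"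
  proof (rule summable_on_SigmaI)
    show "(\<lambda>p. norm (coeff_0F1 a t p) * (c * (1 - \<rho>) powr (- \<beta> p))) summable_on UNIV" by (rule maj)
    show "((\<lambda>T. case (p, T) of (p, T) \<Rightarrow> norm (coeff_0F1 a t p) * (c * (pochhammer (\<beta> p) T / fact T * \<rho> ^ T))) has_sum
        norm (coeff_0F1 a t p) * (c * (1 - \<rho>) powr - \<beta> p)) UNIV" for p
      unfolding prod.case
      by (intro has_sum_cmult_right binomial_series_has_sum \<beta> \<rho>)
    show "0 \<le> (case (p, T) of (p, T) \<Rightarrow> norm (coeff_0F1 a t p) * (c * (pochhammer (\<beta> p) T / fact T * \<rho> ^ T)))" for p T
      using c \<rho> \<beta> by (auto intro!: mult_nonneg_nonneg divide_nonneg_nonneg pochhammer_nonneg_real)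
  qed
  hence "(\<lambda>v. norm (Y v)) summable_on UNIV \<times> UNIV"
  proof (rule Infinite_Sum.abs_summable_on_comparison_test')
    fix v :: "nat \<times> nat"
    obtain p T where v: "v = (p, T)" by (cases v)
    have "norm (pochhammer (a - of_nat p) T) * norm (hom_coeff B1 B2 B3 T)
        \<le> pochhammer (\<beta> p) T * (c * \<rho> ^ T / fact T)"
      unfolding c_def \<rho>_def using \<beta>
      by (intro mult_mono norm_pochhammer_le norm_hom_coeff_le[OF nonneg C B]) (auto intro!: pochhammer_nonneg_real)
    hence "norm (coeff_0F1 a t p) * (norm (pochhammer (a - of_nat p) T) * norm (hom_coeff B1 B2 B3 T))
        \<le> norm (coeff_0F1 a t p) * (pochhammer (\<beta> p) T * (c * \<rho> ^ T / fact T))"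
      by (intro mult_left_mono) auto
    thus "norm (Y v) \<le> (case v of (p, T) \<Rightarrow> norm (coeff_0F1 a t p) * (c * (pochhammer (\<beta> p) T / fact T * \<rho> ^ T)))"
      by (simp add: v Y_def norm_mult mult_ac)
  qed
  hence Y: "(Y has_sum (\<Sum>\<^sub>\<infinity>v. Y v)) (UNIV \<times> UNIV)"
    using has_sum_infsum[OF abs_summable_summable[of Y "UNIV \<times> UNIV"]] by simp
  have "((\<lambda>p. coeff_0F1 a t p * (\<Sum>\<^sub>\<infinity>P. lauricella_term (a - of_nat p) B1 B2 B3 P)) has_sum (\<Sum>\<^sub>\<infinity>v. Y v)) UNIV"
  proof (rule has_sum_SigmaD[OF Y])
    show "((\<lambda>T. Y (p, T)) has_sum coeff_0F1 a t p * (\<Sum>\<^sub>\<infinity>P. lauricella_term (a - of_nat p) B1 B2 B3 P)) UNIV" for p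
      unfolding Y_def prod.case
      by (rule has_sum_cmult_right, rule lauricella_by_degree[OF L])
  qed
  hence 1: "(\<Sum>\<^sub>\<infinity>p. H_summand a t B1 B2 B3 p) = (\<Sum>\<^sub>\<infinity>v. Y v)"
    using H has_sum_unique by blast
  have "((\<lambda>T. pochhammer a T * hom_coeff B1 B2 B3 T * binomial_transform (moment_ratio a t) T 1) has_sum (\<Sum>\<^sub>\<infinity>v. Y v)) UNIV"
  proof (rule has_sum_SigmaD)
    show "((\<lambda>(T, p). Y (p, T)) has_sum (\<Sum>\<^sub>\<infinity>v. Y v)) (UNIV \<times> UNIV)"
      using Y by (subst (asm) has_sum_swap)
    show "((\<lambda>p. case (T, p) of (T, p) \<Rightarrow> Y (p, T)) has_sum
        pochhammer a T * hom_coeff B1 B2 B3 T * binomial_transform (moment_ratio a t) T 1) UNIV" for T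
      using has_sum_cmult_right[OF coeff_transform_at_1[OF a, of t T], of "pochhammer a T * hom_coeff B1 B2 B3 T"]
        pochhammer_a_nonzero(1)[OF a, of T]
      by (simp add: Y_def mult_ac)
  qed
  hence "(\<lambda>T. pochhammer a T * hom_coeff B1 B2 B3 T * binomial_transform (moment_ratio a t) T 1) sums (\<Sum>\<^sub>\<infinity>v. Y v)"
    by (rule has_sum_imp_sums)
  thus ?thesis using 1 sums_unique by metis
qed

end

lemma H043_eq:
  assumes a: "a \<notin> \<int>"
  shows "H043 a b1 b2 b3 d1 d2 d3 x y z t
     = (\<Sum>\<^sub>\<infinity>p. H_summand a t (hyp_coeff b1 d1 x) (hyp_coeff b2 d2 y) (hyp_coeff b3 d3 z) p)"
  unfolding H043_def
proof (rule infsum_reindex_bij_witness[of _ "\<lambda>(l, (m, n, k)). (m, n, k, l)" "\<lambda>(m, n, k, l). (l, (m, n, k))"], goal_cases)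
  case (5 v)
  obtain m n k l where v: "v = (m, n, k, l)" by (cases v)
  have "pochhammer_int a (int m + int n + int k - int l) * t ^ l / fact l
      = coeff_0F1 a t l * pochhammer (a - of_nat l) (m + n + k)"
    using pochhammer_int_eq_coeff_0F1[OF a, of "m + n + k" l t] by simp
  note * = this[symmetric]
  show ?case
    unfolding v prod.case H_summand_def lauricella_term_def mult.assoc[symmetric] times_divide_eq_right *
    by (simp add: hyp_coeff_def mult_ac)
qed auto

text \<open>The summand of the theorem is a product of a factor depending on \<open>q\<close> and one depending on \<open>(i, j, k)\<close>.
  The first parameters of the three Gauss functions are the complements, in the sense of Pfaff's
  transformation, of \<open>a + s + l + m\<close> and twice \<open>a + s + l + m + n\<close>.\<close>

lemma expansion_term_eq:
  fixes x y z :: complex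
  assumes a: "a \<notin> \<int>" and d: "d1 \<notin> \<int>\<^sub>\<le>\<^sub>0" "d2 \<notin> \<int>\<^sub>\<le>\<^sub>0" "d3 \<notin> \<int>\<^sub>\<le>\<^sub>0"
    and x: "norm x < 1" "norm (x / (x - 1)) < 1"
    and y: "norm y < 1" "norm (y / (y - 1)) < 1"
    and z: "norm z < 1" "norm (z / (z - 1)) < 1"
  shows "(1 - x) powr (- b1) * (1 - y) powr (- b2) * (1 - z) powr (- b3)
      * H043_expansion_term a b1 b2 b3 d1 d2 d3 x y z t (l, m, n, s)
    = expansion_summand a t (hyp_coeff b1 d1 x) (hyp_coeff b2 d2 y) (hyp_coeff b3 d3 z) (s, (l, m, n))"
proof -
  define px py pz where p_defs: "px = (1 - x) powr (- b1)" "py = (1 - y) powr (- b2)" "pz = (1 - z) powr (- b3)"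
  define Q where "Q q = A_coeff s q * fact s * of_nat (s choose q) *
      ((- 1) ^ q / (pochhammer (1 - a) q * fact q) * t ^ q * hyp_0F1 (1 - a + of_nat q) (- t))" for q
  define X where "X i j k = pochhammer b1 (i + l + m) / pochhammer d1 (i + l + m) * (x / (1 - x)) ^ (i + l + m)
      * gauss_F (d1 - a - of_nat j - of_nat k) (b1 + of_nat (i + l + m)) (d1 + of_nat (i + l + m)) (x / (x - 1))" for i j k
  define Y where "Y i j k = pochhammer b2 (j + l + n) / pochhammer d2 (j + l + n) * (y / (1 - y)) ^ (j + l + n)
      * gauss_F (d2 - a - of_nat i - of_nat k - of_nat m) (b2 + of_nat (j + l + n)) (d2 + of_nat (j + l + n)) (y / (y - 1))" for i j k
  define Z where "Z i j k = pochhammer b3 (k + m + n) / pochhammer d3 (k + m + n) * (z / (1 - z)) ^ (k + m + n)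
      * gauss_F (d3 - a - of_nat i - of_nat j - of_nat l) (b3 + of_nat (k + m + n)) (d3 + of_nat (k + m + n)) (z / (z - 1))" for i j k
  define R where "R = (\<lambda>(i, j, k). pochhammer a (l + m + n + s) / pochhammer a s
      / (fact l * fact m * fact n) / (fact i * fact j * fact k) * (X i j k * (Y i j k * Z i j k)))"
  have "H043_expansion_term a b1 b2 b3 d1 d2 d3 x y z t (l, m, n, s)
      = (\<Sum>q\<le>s. \<Sum>p\<in>triples s. (- 1) ^ s * Q q * R p)"
    unfolding H043_expansion_term_def triples_def prod.case
    by (intro sum.cong refl)
       (auto simp: Q_def R_def X_def Y_def Z_def power_add mult_ac)
  also have "\<dots> = (- 1) ^ s * (\<Sum>q\<le>s. Q q) * (\<Sum>p\<in>triples s. R p)"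
    by (simp add: sum_distrib_left sum_distrib_right mult_ac)
  also have "(\<Sum>q\<le>s. Q q) = coeff_moment a t s"
    unfolding Q_def by (rule coeff_moment_eq_q_sum[OF a])
  finally have T: "H043_expansion_term a b1 b2 b3 d1 d2 d3 x y z t (l, m, n, s)
      = (- 1) ^ s * coeff_moment a t s * (\<Sum>p\<in>triples s. R p)" .
  have "px * py * pz * R (i, j, k) =
     bc_outer (a + of_nat s) (\<lambda>M. hyp_coeff b1 d1 x (i + M)) (\<lambda>M. hyp_coeff b2 d2 y (j + M))
        (\<lambda>M. hyp_coeff b3 d3 z (k + M)) (l, m, n) / (fact i * fact j * fact k)"
    if ijk: "(i, j, k) \<in> triples s" for i j k
  proof -
    have s: "s = i + j + k" using ijk by (simp add: triples_def)
    have ex: "d1 - a - of_nat j - of_nat k = d1 + of_nat (i + l + m) - (a + of_nat s + of_nat (l + m))"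
      by (simp add: s)
    have ey: "d2 - a - of_nat i - of_nat k - of_nat m = d2 + of_nat (j + l + n) - (a + of_nat s + of_nat (l + m + n))"
      by (simp add: s)
    have ez: "d3 - a - of_nat i - of_nat j - of_nat l = d3 + of_nat (k + m + n) - (a + of_nat s + of_nat (l + m + n))"
      by (simp add: s)
    have X: "px * X i j k = pochhammer_series (a + of_nat s + of_nat (l + m)) (\<lambda>u. hyp_coeff b1 d1 x (i + (l + m + u)))"
      using gauss_factor_eq_pochhammer_series[OF d(1) x, of b1 "i + l + m" "a + of_nat s + of_nat (l + m)"]
      unfolding X_def p_defs ex by (simp only: add.assoc)
    have Y: "py * Y i j k = pochhammer_series (a + of_nat s + of_nat (l + m + n)) (\<lambda>u. hyp_coeff b2 d2 y (j + (l + n + u)))"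
      using gauss_factor_eq_pochhammer_series[OF d(2) y, of b2 "j + l + n" "a + of_nat s + of_nat (l + m + n)"]
      unfolding Y_def p_defs ey by (simp only: add.assoc)
    have Z: "pz * Z i j k = pochhammer_series (a + of_nat s + of_nat (l + m + n)) (\<lambda>u. hyp_coeff b3 d3 z (k + (m + n + u)))"
      using gauss_factor_eq_pochhammer_series[OF d(3) z, of b3 "k + m + n" "a + of_nat s + of_nat (l + m + n)"]
      unfolding Z_def p_defs ez by (simp only: add.assoc)
    have A: "pochhammer a (l + m + n + s) / pochhammer a s = pochhammer (a + of_nat s) (l + m + n)"
      using pochhammer_product'[of a s "l + m + n"] pochhammer_a_nonzero(1)[OF a, of s]
      by (simp add: add.commute)
    have "px * py * pz * R (i, j, k) = pochhammer (a + of_nat s) (l + m + n)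
      / (fact l * fact m * fact n) / (fact i * fact j * fact k) * ((px * X i j k) * ((py * Y i j k) * (pz * Z i j k)))"
      unfolding R_def prod.case A by (simp only: mult_ac times_divide_eq_left times_divide_eq_right)
    thus ?thesis
      unfolding X Y Z bc_outer_def prod.case by simp
  qed
  note R = this
  have "px * py * pz * H043_expansion_term a b1 b2 b3 d1 d2 d3 x y z t (l, m, n, s)
      = (- 1) ^ s * coeff_moment a t s * (\<Sum>p\<in>triples s. px * py * pz * R p)"
    unfolding T sum_distrib_left[symmetric] by (simp only: mult_ac)
  also have "(\<Sum>p\<in>triples s. px * py * pz * R p)
     = shifted_outer a (hyp_coeff b1 d1 x) (hyp_coeff b2 d2 y) (hyp_coeff b3 d3 z) s (l, m, n)"
    unfolding shifted_outer_def by (intro sum.cong refl) (auto simp: R)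
  finally show ?thesis
    unfolding p_defs expansion_summand_def by simp
qed

theorem mainTheorem3:
  fixes a b1 b2 b3 d1 d2 d3 x y z t :: complex
  assumes "a \<notin> \<int>"
    and "d1 \<notin> \<int>\<^sub>\<le>\<^sub>0" and "d2 \<notin> \<int>\<^sub>\<le>\<^sub>0" and "d3 \<notin> \<int>\<^sub>\<le>\<^sub>0"
    and "norm x + norm y + norm z < 1"
    and "norm (x / (x - 1)) < 1" and "norm (y / (y - 1)) < 1" and "norm (z / (z - 1)) < 1"
  shows "(norm x + norm y + norm z < 1 / 2 \<longrightarrow>
            H043_expansion_term a b1 b2 b3 d1 d2 d3 x y z t summable_on UNIV)
       \<and> (H043_expansion_term a b1 b2 b3 d1 d2 d3 x y z t summable_on UNIV \<longrightarrow>
            H043 a b1 b2 b3 d1 d2 d3 x y z t =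
              (1 - x) powr (- b1) * (1 - y) powr (- b2) * (1 - z) powr (- b3)
              * (\<Sum>\<^sub>\<infinity>(l, m, n, s)\<in>UNIV.
                   H043_expansion_term a b1 b2 b3 d1 d2 d3 x y z t (l, m, n, s)))"
proof -
  define T where "T = H043_expansion_term a b1 b2 b3 d1 d2 d3 x y z t"
  define c where "c = (1 - x) powr (- b1) * (1 - y) powr (- b2) * (1 - z) powr (- b3)"
  define V where "V = expansion_summand a t (hyp_coeff b1 d1 x) (hyp_coeff b2 d2 y) (hyp_coeff b3 d3 z)"
  have lt: "norm x < 1" "norm y < 1" "norm z < 1"
    using assms(5) norm_ge_zero[of x] norm_ge_zero[of y] norm_ge_zero[of z] by linarith+
  have ne: "x \<noteq> 1" "y \<noteq> 1" "z \<noteq> 1" using lt by auto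
  have c: "c \<noteq> 0" using ne by (simp add: c_def)
  have TV: "V (s, (l, m, n)) = c * T (l, m, n, s)" for l m n s
    unfolding V_def c_def T_def
    using expansion_term_eq[OF assms(1-4) lt(1) assms(6) lt(2) assms(7) lt(3) assms(8)] by simp
  have TV_sum: "V summable_on UNIV \<longleftrightarrow> (\<lambda>p. c * T p) summable_on UNIV"
    by (rule summable_on_reindex_bij_witness[of _ "\<lambda>(l, m, n, s). (s, (l, m, n))" "\<lambda>(s, (l, m, n)). (l, m, n, s)"])
       (auto simp: TV)
  have TV_infsum: "(\<Sum>\<^sub>\<infinity>p. V p) = (\<Sum>\<^sub>\<infinity>p. c * T p)"
    by (rule infsum_reindex_bij_witness[of _ "\<lambda>(l, m, n, s). (s, (l, m, n))" "\<lambda>(s, (l, m, n)). (l, m, n, s)"])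
       (auto simp: TV)
  have T_sum: "T summable_on UNIV \<longleftrightarrow> V summable_on UNIV"
    unfolding TV_sum using c by (simp add: summable_on_cmult_right')
  have bounds: "\<exists>C1\<ge>0. \<exists>C2\<ge>0. \<exists>C3\<ge>0. (\<forall>M. norm (hyp_coeff b1 d1 x M) \<le> C1 * (q * norm x) ^ M)
      \<and> (\<forall>M. norm (hyp_coeff b2 d2 y M) \<le> C2 * (q * norm y) ^ M)
      \<and> (\<forall>M. norm (hyp_coeff b3 d3 z M) \<le> C3 * (q * norm z) ^ M)" if "1 < q" for q
    using hyp_coeff_bound[OF assms(2) that, of b1 x] hyp_coeff_bound[OF assms(3) that, of b2 y]
      hyp_coeff_bound[OF assms(4) that, of b3 z] by (meson less_imp_le)
  have choose: "\<exists>q>1. q * norm x + q * norm y + q * norm z < r"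
    if r: "norm x + norm y + norm z < r" for r
  proof -
    obtain q where q: "1 < q" "q ^ 4 * (norm x + norm y + norm z) < r"
      using exists_power4_lt[OF _ r] by auto
    have "q ^ 1 * (norm x + norm y + norm z) \<le> q ^ 4 * (norm x + norm y + norm z)"
      using q by (intro mult_right_mono power_increasing) auto
    thus ?thesis using q by (intro exI[of _ q]) (simp add: distrib_left)
  qed
  have part1: "T summable_on UNIV" if half: "norm x + norm y + norm z < 1 / 2"
  proof -
    obtain q where q: "1 < q" "q * norm x + q * norm y + q * norm z < 1 / 2"
      using choose[OF half] by blast
    obtain C1 C2 C3 where C: "0 \<le> C1" "0 \<le> C2" "0 \<le> C3"
      and B: "\<And>M. norm (hyp_coeff b1 d1 x M) \<le> C1 * (q * norm x) ^ M"
        "\<And>M. norm (hyp_coeff b2 d2 y M) \<le> C2 * (q * norm y) ^ M"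
        "\<And>M. norm (hyp_coeff b3 d3 z M) \<le> C3 * (q * norm z) ^ M"
      using bounds[OF q(1)] by blast
    have nn: "0 \<le> q * norm x" "0 \<le> q * norm y" "0 \<le> q * norm z" using q by auto
    have "V summable_on UNIV"
      unfolding V_def by (rule expansion_summable[OF assms(1) C nn _ B q(2)]) (use q in simp)
    thus ?thesis using T_sum by simp
  qed
  have part2: "H043 a b1 b2 b3 d1 d2 d3 x y z t = c * (\<Sum>\<^sub>\<infinity>p. T p)" if "T summable_on UNIV"
  proof -
    obtain q where q: "1 < q" "q * norm x + q * norm y + q * norm z < 1"
      using choose[OF assms(5)] by blast
    obtain C1 C2 C3 where C: "0 \<le> C1" "0 \<le> C2" "0 \<le> C3"
      and B: "\<And>M. norm (hyp_coeff b1 d1 x M) \<le> C1 * (q * norm x) ^ M"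
        "\<And>M. norm (hyp_coeff b2 d2 y M) \<le> C2 * (q * norm y) ^ M"
        "\<And>M. norm (hyp_coeff b3 d3 z M) \<le> C3 * (q * norm z) ^ M"
      using bounds[OF q(1)] by blast
    have nn: "0 \<le> q * norm x" "0 \<le> q * norm y" "0 \<le> q * norm z" using q by auto
    have V: "V summable_on UNIV" using T_sum that by simp
    have "H043 a b1 b2 b3 d1 d2 d3 x y z t = (\<Sum>\<^sub>\<infinity>p. V p)"
      unfolding H043_eq[OF assms(1)] H_infsum[OF assms(1) C nn q(2) B] V_def
      by (rule expansion_infsum[OF assms(1) C nn q(2) B V[unfolded V_def], symmetric])
    also have "\<dots> = c * (\<Sum>\<^sub>\<infinity>p. T p)"
      unfolding TV_infsum by (rule infsum_cmult_right')
    finally show ?thesis .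
  qed
  have "(\<Sum>\<^sub>\<infinity>(l, m, n, s)\<in>UNIV. T (l, m, n, s)) = (\<Sum>\<^sub>\<infinity>p. T p)"
    by (rule infsum_cong) auto
  thus ?thesis using part1 part2 unfolding T_def c_def by simp
qed

end
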